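(* (a) If $\mathrm{CH}(B_i\cup B_j)=[0,u]$ for all $i\neq j$ in $\{0,1,2\}$, then the implicit polygon $N(\phi)$ is the triangle with vertices $(0,0),(0,u),(u,0)$. (b) If exactly one support, say $B_k$, $k\in\{0,1,2\}$, equals $[0,u]$ (i.e. $b_{kL}=0$, $b_{kR}=u$), then $N(\phi)$ has up to $5$ vertices, and they lie in the following set of $(e_i,e_j)$ vectors: $$\{(u,0),\ (0,u),\ (0,u-b_{iR}+b_{iL}),\ (b_{jL},u-b_{iR}),\ (u-b_{jR}+b_{jL},0)\},$$ where $\{i,j,k\}=\{0,1,2\}$ and $i,j$ are chosen so that $$b_{iL}(u-b_{jR})\ \ge\ b_{jL}(u-b_{iR}).$$
   Context: Consider $x=P_0(t)/Q(t)$, $y=P_1(t)/Q(t)$ with $P_0,P_1,Q\in\mathbb{C}[t]$ having fixed supports and generic coefficients (the result holds for all coefficient vectors in some open dense subset), $\gcd(P_i,Q)=1$ for $i=0,1$, and parameterization of degree $1$. Let $\phi\in\mathbb{C}[x,y]$ be the implicit equation (generator of the ideal of polynomials vanishing on the parameterization) and $N(\phi)$ its Newton polygon (convex hull of the exponent vectors occurring in $\phi$). Let $B_0,B_1,B_2\subset\mathbb{N}$ be the supports of $P_0,P_1,Q$ respectively, with $b_{iL}=\min B_i$, $b_{iR}=\max B_i$; $B_i$ is also identified with the segment $[b_{iL},b_{iR}]$. Let $u=\max\{b_{0R},b_{1R},b_{2R}\}$. $\mathrm{CH}$ denotes convex hull. Coordinates: let $\Phi(x_0,x_1,x_2)$ be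 the homogeneous implicit equation, of degree $u$, with $\phi(x,y)=\Phi(x,y,1)$. An exponent $(e_0,e_1)$ of $\phi$ corresponds to the exponent $(e_0,e_1,e_2)$ of $\Phi$ with $e_0+e_1+e_2=u$; a point of $N(\phi)$ is thus described by any two of the coordinates $e_0,e_1,e_2$, in particular by $(e_i,e_j)$, with the third given by $e_k=u-e_i-e_j$. *)

theory Defs
  imports "HOL-Analysis.Analysis" "HOL-Computational_Algebra.Computational_Algebra"
begin

text \<open>Functions on the affine space of all \<open>c : S \<rightarrow> \<complex>\<close> given by a polynomial in the
  coordinates \<open>c s\<close>, \<open>s \<in> S\<close>.\<close>

inductive_set polynomial_maps :: "'s set \<Rightarrow> (('s \<Rightarrow> complex) \<Rightarrow> complex) set"
  for S :: "'s set" where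
  const: "(\<lambda>c. a) \<in> polynomial_maps S"
| coord: "s \<in> S \<Longrightarrow> (\<lambda>c. c s) \<in> polynomial_maps S"
| add: "f \<in> polynomial_maps S \<Longrightarrow> g \<in> polynomial_maps S \<Longrightarrow> (\<lambda>c. f c + g c) \<in> polynomial_maps S"
| mult: "f \<in> polynomial_maps S \<Longrightarrow> g \<in> polynomial_maps S \<Longrightarrow> (\<lambda>c. f c * g c) \<in> polynomial_maps S"

definition zariski_topology :: "'s set \<Rightarrow> ('s \<Rightarrow> complex) topology" where
  "zariski_topology S =
     topology_generated_by {{c \<in> S \<rightarrow>\<^sub>E UNIV. f c \<noteq> 0} |f. f \<in> polynomial_maps S}"

text \<open>``Open dense'' is meant in the Zariski topology. For finite \<open>S\<close>, a set that is open and
  dense in this sense is also open and dense in the Euclidean topology.\<close>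

definition generically :: "'s set \<Rightarrow> (('s \<Rightarrow> complex) \<Rightarrow> bool) \<Rightarrow> bool" where
  "generically S P \<longleftrightarrow>
     (\<exists>U. openin (zariski_topology S) U
        \<and> zariski_topology S closure_of U = topspace (zariski_topology S)
        \<and> (\<forall>c\<in>U. P c))"

text \<open>\<open>B 0\<close>, \<open>B 1\<close>, \<open>B 2\<close> are the supports of \<open>P\<^sub>0\<close>, \<open>P\<^sub>1\<close> and \<open>Q\<close>; the entry \<open>c (i, b)\<close> of a
  coefficient vector is the coefficient of \<open>t ^ b\<close> in the \<open>i\<close>-th of these polynomials.\<close>

definition coeff_index :: "(nat \<Rightarrow> nat set) \<Rightarrow> (nat \<times> nat) set" where
  "coeff_index B = (SIGMA i:{0, 1, 2}. B i)"

definition supp_poly :: "(nat \<Rightarrow> nat set) \<Rightarrow> (nat \<times> nat \<Rightarrow> complex) \<Rightarrow> nat \<Rightarrow> complex poly" where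
  "supp_poly B c i = (\<Sum>b\<in>B i. monom (c (i, b)) b)"

text \<open>Number of parameter values over the generic point of the image. If the fibres are
  infinite (constant parameterization), this holds for \<open>d = 0\<close> only.\<close>

definition has_param_degree ::
    "complex poly \<Rightarrow> complex poly \<Rightarrow> complex poly \<Rightarrow> nat \<Rightarrow> bool" where
  "has_param_degree P0 P1 Q d \<longleftrightarrow>
     (\<forall>\<^sub>F t in cofinite. poly Q t \<noteq> 0 \<and>
        card {s. poly Q s \<noteq> 0 \<and> poly P0 s / poly Q s = poly P0 t / poly Q t
                             \<and> poly P1 s / poly Q s = poly P1 t / poly Q t} = d)"

text \<open>\<open>\<complex>[x, y]\<close> is represented as \<open>\<complex>[x][y]\<close>: the coefficient of \<open>x ^ m * y ^ n\<close> in \<open>f\<close> is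
  \<open>coeff (coeff f n) m\<close>.\<close>

definition eval2 :: "complex poly poly \<Rightarrow> complex \<Rightarrow> complex \<Rightarrow> complex" where
  "eval2 f x y = poly (poly f [:y:]) x"

definition vanishing_ideal ::
    "complex poly \<Rightarrow> complex poly \<Rightarrow> complex poly \<Rightarrow> complex poly poly set" where
  "vanishing_ideal P0 P1 Q =
     {f. \<forall>t. poly Q t \<noteq> 0 \<longrightarrow> eval2 f (poly P0 t / poly Q t) (poly P1 t / poly Q t) = 0}"

definition is_implicit_equation ::
    "complex poly \<Rightarrow> complex poly \<Rightarrow> complex poly \<Rightarrow> complex poly poly \<Rightarrow> bool" where
  "is_implicit_equation P0 P1 Q \<phi> \<longleftrightarrow> vanishing_ideal P0 P1 Q = {f. \<phi> dvd f}"

definition newton_polygon :: "complex poly poly \<Rightarrow> (real \<times> real) set" where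
  "newton_polygon f = convex hull {(real m, real n) |m n. coeff (coeff f n) m \<noteq> 0}"

definition vertices :: "(real \<times> real) set \<Rightarrow> (real \<times> real) set" where
  "vertices S = {v. v extreme_point_of S}"

text \<open>The coordinate \<open>e\<^sub>l\<close>, \<open>l \<in> {0, 1, 2}\<close>, of the point \<open>(e\<^sub>0, e\<^sub>1)\<close>, where
  \<open>e\<^sub>0 + e\<^sub>1 + e\<^sub>2 = u\<close>.\<close>

definition hom_coord :: "nat \<Rightarrow> nat \<Rightarrow> real \<times> real \<Rightarrow> real" where
  "hom_coord u l e = (if l = 0 then fst e else if l = 1 then snd e else real u - fst e - snd e)"

text \<open>The setting: \<open>\<phi>\<close> is the implicit equation of \<open>x = P\<^sub>0 / Q\<close>, \<open>y = P\<^sub>1 / Q\<close>, where the fractions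
  are reduced and the parameterization has degree 1.\<close>

definition implicitization ::
    "(nat \<Rightarrow> nat set) \<Rightarrow> (nat \<times> nat \<Rightarrow> complex) \<Rightarrow> complex poly poly \<Rightarrow> bool" where
  "implicitization B c \<phi> \<longleftrightarrow>
     (let P0 = supp_poly B c 0; P1 = supp_poly B c 1; Q = supp_poly B c 2 in
        coprime P0 Q \<and> coprime P1 Q \<and> has_param_degree P0 P1 Q 1
        \<and> is_implicit_equation P0 P1 Q \<phi>)"

end

theory Submission
  imports Defs "Jordan_Normal_Form.Determinant" "HOL-Computational_Algebra.Field_as_Ring"
begin

text \<open>Write \<open>P\<^sub>2 = Q\<close> and use homogeneous coordinates \<open>x\<^sub>0, x\<^sub>1, x\<^sub>2\<close>. If a point is
  \<open>(P\<^sub>0(t) : P\<^sub>1(t) : P\<^sub>2(t))\<close>, scaled suitably, then the \<open>3 u\<close> equations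
  \<open>t ^ m * P\<^sub>r(t) - x\<^sub>r * t ^ m = 0\<close> with \<open>r \<le> 2\<close> and \<open>m < u\<close> hold. They are linear in the \<open>2 u\<close>
  quantities \<open>t ^ l\<close> in which the left summand is expanded and in the \<open>u\<close> quantities \<open>t ^ m\<close> by which
  \<open>x\<^sub>r\<close> is multiplied. The determinant \<open>D\<close> of this square system (\<open>implicit_det\<close>) is
  homogeneous of degree \<open>u\<close> in \<open>x\<^sub>0, x\<^sub>1, x\<^sub>2\<close> and vanishes on the curve, so \<open>\<phi>\<close> divides it.
  On the other hand a generic line \<open>x = a\<close>, or else a generic line \<open>y = a\<close>, meets the curve in \<open>u\<close>
  different points, because the parameterization has degree 1; so \<open>\<phi>\<close> already has degree at least \<open>u\<close>, and
  \<open>D\<close> is a constant multiple of \<open>\<phi>\<close> unless it is zero (\<open>implicit_equation_proportional\<close>).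

  It remains to find the Newton polygon of \<open>D\<close>. In the Leibniz formula a permutation either
  sends row \<open>(r, m)\<close> to its \<open>x\<^sub>r\<close>-column, or to a column \<open>m + s\<close> where \<open>s\<close> is an exponent of
  \<open>P\<^sub>r\<close>; such an assignment is called a placement, and the exponent of \<open>x\<^sub>r\<close> in the
  corresponding term counts the rows of block \<open>r\<close> that are sent to \<open>x\<close>-columns. So the support of
  \<open>D\<close> is a question about placements.

  \<^item> Every placement satisfies the inequalities that cut out the polygon (\<open>weight_bound\<close>). Bounding
    a weighted count of rows is an assignment problem, and the bound is certified by row and
    column potentials, that is, by a feasible solution of the dual linear program.

  \<^item> Every vertex is attained. For a suitable choice of one or two exponents from each support there
    is exactly one placement with the exponents of that vertex (\<open>edge_placement_unique\<close>,
    \<open>inner_placement_unique\<close>). Hence the corresponding coefficient of \<open>D\<close> is \<open>\<plusminus>1\<close> for a coefficient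
    vector with entries 0 and 1, and therefore a nonzero polynomial in the coefficient vector
    (\<open>unique_placement_in_support\<close>).

  Finitely many nonzero polynomials are simultaneously nonzero on a dense open set, which gives
  the genericity. That the convex hull of the attained vertices is all of \<open>N(\<phi>)\<close> is checked by
  comparing support functions (\<open>pentagon_support_function\<close>): for each linear functional one of the
  vertices is at least as extreme as every exponent of \<open>D\<close>.\<close>

section \<open>Zariski-generic coefficient vectors\<close>

lemma polynomial_maps_sum:
  assumes "\<And>a. a \<in> A \<Longrightarrow> f a \<in> polynomial_maps S"
  shows "(\<lambda>c. \<Sum>a\<in>A. f a c) \<in> polynomial_maps S"
  using assms
  by (induction A rule: infinite_finite_induct) (auto intro: polynomial_maps.intros)

lemma polynomial_maps_prod:
  assumes "\<And>a. a \<in> A \<Longrightarrow> f a \<in> polynomial_maps S"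
  shows "(\<lambda>c. \<Prod>a\<in>A. f a c) \<in> polynomial_maps S"
  using assms
  by (induction A rule: infinite_finite_induct) (auto intro: polynomial_maps.intros)

lemma polynomial_maps_restrict:
  "f \<in> polynomial_maps S \<Longrightarrow> f (restrict c S) = f c"
  by (induction rule: polynomial_maps.induct) auto

text \<open>Restricting to a line reduces questions about polynomial maps on the coefficient space to
  polynomials in one variable.\<close>

lemma polynomial_maps_on_line:
  "f \<in> polynomial_maps S \<Longrightarrow> \<exists>p. \<forall>s. f (\<lambda>i. a i + s * d i) = poly p s"
proof (induction rule: polynomial_maps.induct)
  case (const b)
  show ?case by (intro exI[of _ "[:b:]"]) simp
next
  case (coord i)
  show ?case by (intro exI[of _ "[:a i, d i:]"]) simp
next
  case (add f g)
  then show ?case by (metis poly_add)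
next
  case (mult f g)
  then show ?case by (metis poly_mult)
qed

text \<open>The coefficient space is irreducible: on the line through a point where \<open>f\<close> does not vanish and
  one where \<open>g\<close> does not, both are nonzero polynomials in one variable, and so is their product.
  This is what makes nonempty open sets dense.\<close>

lemma polynomial_maps_mult_nonzero:
  assumes f: "f \<in> polynomial_maps S" and g: "g \<in> polynomial_maps S"
    and a: "f a \<noteq> 0" and b: "g b \<noteq> 0"
  shows "\<exists>c. f c * g c \<noteq> 0"
proof -
  define d where "d = (\<lambda>i. b i - a i)"
  obtain p where p: "\<And>s. f (\<lambda>i. a i + s * d i) = poly p s"
    using polynomial_maps_on_line[OF f] by blast
  obtain q where q: "\<And>s. g (\<lambda>i. a i + s * d i) = poly q s"
    using polynomial_maps_on_line[OF g] by blast
  have "poly p 0 \<noteq> 0" using p[of 0] a by simp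
  moreover have "poly q 1 \<noteq> 0" using q[of 1] b by (simp add: d_def)
  ultimately have "p * q \<noteq> 0" by auto
  then obtain s where "poly (p * q) s \<noteq> 0"
    using poly_all_0_iff_0 by blast
  then show ?thesis using p q by (metis poly_mult)
qed

lemma polynomial_maps_prod_nonzero:
  assumes "finite A" "\<And>a. a \<in> A \<Longrightarrow> f a \<in> polynomial_maps S"
    and "\<And>a. a \<in> A \<Longrightarrow> \<exists>c. f a c \<noteq> 0"
  shows "\<exists>c. (\<Prod>a\<in>A. f a c) \<noteq> 0"
  using assms
proof (induction A rule: finite_induct)
  case empty
  then show ?case by simp
next
  case (insert a A)
  then obtain c d where "f a c \<noteq> 0" "(\<Prod>a\<in>A. f a d) \<noteq> 0" by blast
  then have "\<exists>c. f a c * (\<Prod>a\<in>A. f a c) \<noteq> 0"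
    using insert.prems(1) polynomial_maps_prod[of A f S]
    by (intro polynomial_maps_mult_nonzero[where f = "f a" and g = "\<lambda>c. \<Prod>a\<in>A. f a c"]) auto
  then show ?case using insert.hyps by simp
qed

lemma zariski_open_contains_basic:
  assumes "openin (zariski_topology S) T" "x \<in> T"
  shows "\<exists>g\<in>polynomial_maps S. g x \<noteq> 0 \<and> {c \<in> S \<rightarrow>\<^sub>E UNIV. g c \<noteq> 0} \<subseteq> T"
proof -
  let ?\<B> = "{{c \<in> S \<rightarrow>\<^sub>E UNIV. f c \<noteq> 0} |f. f \<in> polynomial_maps S}"
  have "generate_topology_on ?\<B> T"
    using assms(1) unfolding zariski_topology_def by (rule openin_topology_generated_by)
  then show ?thesis using assms(2)
  proof (induction arbitrary: x rule: generate_topology_on.induct)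
    case Empty
    then show ?case by simp
  next
    case (Int V W)
    from Int.prems have "x \<in> V" "x \<in> W" by auto
    from Int.IH(1)[OF this(1)] Int.IH(2)[OF this(2)]
    obtain g h where "g \<in> polynomial_maps S" "g x \<noteq> 0" "{c \<in> S \<rightarrow>\<^sub>E UNIV. g c \<noteq> 0} \<subseteq> V"
      "h \<in> polynomial_maps S" "h x \<noteq> 0" "{c \<in> S \<rightarrow>\<^sub>E UNIV. h c \<noteq> 0} \<subseteq> W"
      by (elim bexE conjE)
    then show ?case
      by (intro bexI[OF _ polynomial_maps.mult[of g S h]]) auto
  next
    case (UN K)
    then obtain V where "V \<in> K" "x \<in> V" by blast
    from UN.IH[OF this] show ?case using \<open>V \<in> K\<close> by blast
  next
    case (Basis V)
    then show ?case by blast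
  qed
qed

lemma generically_nonvanishing:
  assumes f: "f \<in> polynomial_maps S" and a: "f a \<noteq> 0"
    and P: "\<And>c. c \<in> S \<rightarrow>\<^sub>E UNIV \<Longrightarrow> f c \<noteq> 0 \<Longrightarrow> P c"
  shows "generically S P"
proof -
  let ?\<B> = "{{c \<in> S \<rightarrow>\<^sub>E UNIV. f c \<noteq> 0} |f. f \<in> polynomial_maps S}"
  let ?U = "{c \<in> S \<rightarrow>\<^sub>E UNIV. f c \<noteq> 0}"
  have op: "openin (zariski_topology S) ?U"
    unfolding zariski_topology_def by (rule topology_generated_by_Basis) (use f in blast)
  have "x \<in> zariski_topology S closure_of ?U" if x: "x \<in> topspace (zariski_topology S)" for x
    unfolding in_closure_of
  proof (intro conjI x allI impI, elim conjE)
    fix T assume T: "x \<in> T" "openin (zariski_topology S) T"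
    from zariski_open_contains_basic[OF T(2,1)] obtain g where
      g: "g \<in> polynomial_maps S" "g x \<noteq> 0" "{c \<in> S \<rightarrow>\<^sub>E UNIV. g c \<noteq> 0} \<subseteq> T" by blast
    obtain c where "f c * g c \<noteq> 0"
      using polynomial_maps_mult_nonzero[where f = f and g = g, OF f g(1) a g(2)] by blast
    then have "f c \<noteq> 0" "g c \<noteq> 0" by auto
    then have "restrict c S \<in> ?U" "restrict c S \<in> T"
      using polynomial_maps_restrict[OF f] polynomial_maps_restrict[OF g(1)] g(3) by auto
    then show "\<exists>y. y \<in> ?U \<and> y \<in> T" by blast
  qed
  then have "zariski_topology S closure_of ?U = topspace (zariski_topology S)"
    by (intro equalityI closure_of_subset_topspace subsetI)
  with op P show ?thesis unfolding generically_def by auto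
qed

section \<open>Placements\<close>

text \<open>Row \<open>(r, m)\<close> of the \<open>3 u\<close> by \<open>3 u\<close> matrix has entries in the columns \<open>m + s\<close>, where \<open>s\<close> runs
  through the exponents \<open>S r\<close> of the \<open>r\<close>-th polynomial, and in the column \<open>2 u + m\<close>, where the
  entry is the coordinate \<open>x\<^sub>r\<close>. A placement is a permutation that hits only such entries. The
  columns from \<open>2 u\<close> on are called extra columns.\<close>

definition placement :: "nat \<Rightarrow> (nat \<Rightarrow> nat set) \<Rightarrow> (nat \<Rightarrow> nat \<Rightarrow> nat) \<Rightarrow> bool" where
  "placement u S F \<longleftrightarrow>
     bij_betw (\<lambda>(r, m). F r m) ({0, 1, 2} \<times> {..<u}) {..<3 * u} \<and>
     (\<forall>r\<in>{0, 1, 2}. \<forall>m<u. F r m = 2 * u + m \<or> (\<exists>s\<in>S r. s \<le> u \<and> F r m = m + s))"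

text \<open>The exponent of \<open>x\<^sub>r\<close> in the term of the determinant that belongs to \<open>F\<close>.\<close>

definition num_ext :: "nat \<Rightarrow> (nat \<Rightarrow> nat \<Rightarrow> nat) \<Rightarrow> nat \<Rightarrow> nat" where
  "num_ext u F r = card {m. m < u \<and> F r m = 2 * u + m}"

lemma placement_mono:
  assumes F: "placement u S F" and S: "\<And>r. r \<in> {0, 1, 2} \<Longrightarrow> S r \<subseteq> S' r"
  shows "placement u S' F"
proof -
  have opt: "\<forall>r\<in>{0, 1, 2}. \<forall>m<u. F r m = 2 * u + m \<or> (\<exists>s\<in>S r. s \<le> u \<and> F r m = m + s)"
    using F unfolding placement_def by (rule conjunct2)
  show ?thesis
    unfolding placement_def
  proof (intro conjI ballI allI impI)
    show "bij_betw (\<lambda>(r, m). F r m) ({0, 1, 2} \<times> {..<u}) {..<3 * u}"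
      using F unfolding placement_def by (rule conjunct1)
    fix r m :: nat assume r: "r \<in> {0, 1, 2}" and "m < u"
    then show "F r m = 2 * u + m \<or> (\<exists>s\<in>S' r. s \<le> u \<and> F r m = m + s)"
      using opt[rule_format, of r m] S[OF r] by blast
  qed
qed

lemma roles_distinct:
  assumes "{i, j, k} = {0, 1, 2::nat}"
  shows "i \<noteq> j" "i \<noteq> k" "j \<noteq> k"
proof -
  have "card {i, j, k} = 3" using assms by simp
  then show "i \<noteq> j" "i \<noteq> k" "j \<noteq> k" by (auto simp: card_insert_if split: if_splits)
qed

text \<open>The three blocks of rows enter symmetrically, and the statements below are needed for several
  assignments of the names \<open>i\<close>, \<open>j\<close>, \<open>k\<close> to them.\<close>

locale placement_roles =
  fixes u :: nat and S :: "nat \<Rightarrow> nat set" and F :: "nat \<Rightarrow> nat \<Rightarrow> nat" and i j k :: nat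
  assumes roles: "{i, j, k} = {0, 1, 2}" and placement: "placement u S F"
begin

lemmas distinct_roles = roles_distinct[OF roles]

lemma placement_cases:
  "r \<in> {i, j, k} \<Longrightarrow> m < u \<Longrightarrow> F r m = 2 * u + m \<or> (\<exists>s\<in>S r. s \<le> u \<and> F r m = m + s)"
  using placement unfolding placement_def roles by blast

lemma placement_injD:
  assumes "F r m = F r' m'" "r \<in> {i, j, k}" "r' \<in> {i, j, k}" "m < u" "m' < u"
  shows "r = r' \<and> m = m'"
proof -
  have "inj_on (\<lambda>(r, m). F r m) ({i, j, k} \<times> {..<u})"
    using placement unfolding placement_def bij_betw_def roles by blast
  from inj_onD[OF this, of "(r, m)" "(r', m')"] assms show ?thesis by simp
qed

lemma column_covered:
  assumes "c < 3 * u"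
  obtains m where "m < u" "F i m = c \<or> F j m = c \<or> F k m = c"
proof -
  have "c \<in> (\<lambda>(r, m). F r m) ` ({i, j, k} \<times> {..<u})"
    using assms placement unfolding placement_def bij_betw_def roles by auto
  then show thesis using that by auto
qed

text \<open>Only the rows \<open>(r, m)\<close> with the same \<open>m\<close> have an entry in the extra column \<open>2 u + m\<close>, so exactly
  one of the three occupies it. Hence the counts \<open>num_ext\<close> add up to \<open>u\<close>, which is the
  homogeneity of the determinant.\<close>

lemma one_ext:
  assumes "m < u"
  shows "F i m = 2 * u + m \<or> F j m = 2 * u + m \<or> F k m = 2 * u + m"
proof -
  obtain m' where m': "m' < u" "F i m' = 2 * u + m \<or> F j m' = 2 * u + m \<or> F k m' = 2 * u + m"
    using column_covered[of "2 * u + m"] assms by auto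
  have "m' = m" if "F r m' = 2 * u + m" "r \<in> {i, j, k}" for r
    using placement_cases[OF that(2) m'(1)] that(1) m'(1) by auto
  with m' show ?thesis by auto
qed

lemma not_two_ext:
  assumes "m < u"
  shows "F i m = 2 * u + m \<Longrightarrow> F j m \<noteq> 2 * u + m"
    and "F i m = 2 * u + m \<Longrightarrow> F k m \<noteq> 2 * u + m"
    and "F j m = 2 * u + m \<Longrightarrow> F k m \<noteq> 2 * u + m"
  using placement_injD[of i m j m] placement_injD[of i m k m] placement_injD[of j m k m] assms distinct_roles by auto

lemma all_ext_iff: "num_ext u F r = u \<longleftrightarrow> (\<forall>m<u. F r m = 2 * u + m)"
proof
  assume "num_ext u F r = u"
  then have "{m. m < u \<and> F r m = 2 * u + m} = {..<u}"
    unfolding num_ext_def by (intro card_subset_eq) auto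
  then show "\<forall>m<u. F r m = 2 * u + m" by auto
next
  assume "\<forall>m<u. F r m = 2 * u + m"
  then have "{m. m < u \<and> F r m = 2 * u + m} = {..<u}" by auto
  then show "num_ext u F r = u" unfolding num_ext_def by simp
qed

lemma ext_set_eqI':
  assumes "{m. m < u \<and> F r m = 2 * u + m} \<subseteq> A" "finite A" "card A = num_ext u F r"
  shows "{m. m < u \<and> F r m = 2 * u + m} = A"
  using assms unfolding num_ext_def by (intro card_subset_eq) auto

lemma ext_set_eqI:
  assumes "A \<subseteq> {m. m < u \<and> F r m = 2 * u + m}" "card A = num_ext u F r"
  shows "{m. m < u \<and> F r m = 2 * u + m} = A"
  using assms unfolding num_ext_def by (intro card_subset_eq[symmetric]) auto

section \<open>Placements that belong to a vertex are unique\<close>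

text \<open>The exponent with \<open>e\<^sub>i = 0\<close> and \<open>e\<^sub>j = u - (bR - bL)\<close>. The rows of block \<open>i\<close> reach neither the
  columns below \<open>bL\<close> nor those from \<open>u + bR\<close> on, so these are filled by block \<open>k\<close>, working inwards
  from both ends; the prescribed counts then leave no more rows of block \<open>k\<close> and force the rows
  of block \<open>j\<close> between \<open>bL\<close> and \<open>bR\<close>, and block \<open>i\<close> fills the gaps from left to right. The
  conditions on \<open>\<beta>\<close> keep block \<open>j\<close> away from the outermost columns. The case \<open>bL = bR\<close>, in which
  all rows of block \<open>j\<close> are in extra columns, is the corner \<open>e\<^sub>j = u\<close>.\<close>

lemma edge_placement_unique:
  assumes Si: "S i \<subseteq> {bL, bR}" and Sj: "S j \<subseteq> {\<beta>}" and Sk: "S k \<subseteq> {0, u}"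
    and b: "bL \<le> bR" "bR \<le> u" "\<beta> \<le> u"
    and sep: "bL < bR \<Longrightarrow> bL = 0 \<or> 0 < \<beta>" "bL < bR \<Longrightarrow> bR = u \<or> \<beta> < u"
    and num: "num_ext u F i = 0" "num_ext u F j = u - (bR - bL)"
    and m: "m < u"
  shows "F k m = (if m < bL then m else if bR \<le> m then m + u else 2 * u + m)"
    and "F j m = (if bL \<le> m \<and> m < bR then m + \<beta> else 2 * u + m)"
    and "F i m = (if m < \<beta> then m + bL else m + bR)"
proof -
  have opt_i: "F i m = m + bL \<or> F i m = m + bR" if "m < u" for m
  proof -
    have "F i m \<noteq> 2 * u + m" using num(1) that unfolding num_ext_def by auto
    then show ?thesis using placement_cases[of i m] that Si by auto
  qed
  have opt_j: "F j m = m + \<beta> \<or> F j m = 2 * u + m" if "m < u" for m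
    using placement_cases[of j m] that Sj by auto
  have opt_k: "F k m = m \<or> F k m = m + u \<or> F k m = 2 * u + m" if "m < u" for m
    using placement_cases[of k m] that Sk by auto
  have one: "F j m = 2 * u + m \<longleftrightarrow> F k m \<noteq> 2 * u + m" if "m < u" for m
    using one_ext[OF that] not_two_ext[OF that] opt_i[OF that] b that by auto
  have j_all: "F j m = 2 * u + m" if "bL = bR" "m < u" for m
    using num(2) that all_ext_iff[of j] by auto
  have low: "F k m = m" if "m < bL" for m
    using that
  proof (induction m rule: less_induct)
    case (less m)
    have "m < u" using less.prems b by simp
    then obtain m' where m': "m' < u" "F i m' = m \<or> F j m' = m \<or> F k m' = m"
      using column_covered[of m] by auto
    have "F j m' \<noteq> m"
    proof
      assume j: "F j m' = m"
      then have "m' + \<beta> = m" "F j m' \<noteq> 2 * u + m'" using opt_j[OF m'(1)] \<open>m < u\<close> by auto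
      moreover from this have "bL < bR" using j_all[of m'] m' b by fastforce
      ultimately have "m' < m" using sep(1) less.prems by auto
      then show False using less.IH[of m'] less.prems one[OF m'(1)] \<open>F j m' \<noteq> 2 * u + m'\<close> m'(1) by auto
    qed
    moreover have "F i m' \<noteq> m" using opt_i[OF m'(1)] less.prems b by auto
    ultimately show ?case using m' opt_k[OF m'(1)] \<open>m < u\<close> by auto
  qed
  have high: "F k m = m + u" if "bR \<le> m" "m < u" for m
    using that
  proof (induction "u - m" arbitrary: m rule: less_induct)
    case less
    obtain m' where m': "m' < u" "F i m' = m + u \<or> F j m' = m + u \<or> F k m' = m + u"
      using column_covered[of "m + u"] less.prems by auto
    have "F j m' \<noteq> m + u"
    proof
      assume j: "F j m' = m + u"
      then have m'_eq: "m' + \<beta> = m + u" "F j m' \<noteq> 2 * u + m'" using opt_j[OF m'(1)] less.prems by auto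
      moreover from this have "bL < bR" using j_all[of m'] m' b by fastforce
      ultimately have "m < m'" using sep(2) less.prems b by auto
      then show False using less.hyps[of m'] less.prems one[OF m'(1)] m'_eq m'(1) by auto
    qed
    moreover have "F i m' \<noteq> m + u" using opt_i[OF m'(1)] m'(1) less.prems b by auto
    ultimately show ?case using m' opt_k[OF m'(1)] less.prems by auto
  qed
  have "{m. m < u \<and> F j m = 2 * u + m} = {..<bL} \<union> {bR..<u}"
  proof (rule ext_set_eqI)
    show "{..<bL} \<union> {bR..<u} \<subseteq> {m. m < u \<and> F j m = 2 * u + m}"
      using low high one b by fastforce
    have "card ({..<bL} \<union> {bR..<u}) = card {..<bL} + card {bR..<u}"
      using b by (intro card_Un_disjoint) auto
    then show "card ({..<bL} \<union> {bR..<u}) = num_ext u F j" using num b by simp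
  qed
  then have j_ext: "F j m = 2 * u + m \<longleftrightarrow> m < bL \<or> bR \<le> m" if "m < u" for m
    using that by (auto simp: set_eq_iff)
  have j_eq: "F j m = (if bL \<le> m \<and> m < bR then m + \<beta> else 2 * u + m)" if "m < u" for m
    using j_ext[OF that] opt_j[OF that] by auto
  have k_eq: "F k m = (if m < bL then m else if bR \<le> m then m + u else 2 * u + m)" if "m < u" for m
    using low high j_ext[OF that] one[OF that] that by auto
  have i_low: "F i m = m + bL" if "m < \<beta>" "m < u" for m
    using that
  proof (induction m rule: less_induct)
    case (less m)
    obtain m' where m': "m' < u" "F i m' = m + bL \<or> F j m' = m + bL \<or> F k m' = m + bL"
      using column_covered[of "m + bL"] less.prems b by auto
    have "F j m' \<noteq> m + bL" using j_eq[OF m'(1)] less.prems b by auto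
    moreover have "F k m' \<noteq> m + bL" using k_eq[OF m'(1)] less.prems b m' by auto
    ultimately have i: "F i m' = m + bL" using m' by blast
    show ?case
    proof (cases "m' < m")
      case True
      then have "F i m' = m' + bL" using less.IH[of m'] less.prems by auto
      then show ?thesis using True i by simp
    next
      case False
      then have "m' = m" using opt_i[OF m'(1)] i b by auto
      then show ?thesis using i by simp
    qed
  qed
  have i_high: "F i m = m + bR" if "\<beta> \<le> m" "m < u" for m
    using that
  proof (induction m rule: less_induct)
    case (less m)
    show ?case
    proof (rule ccontr)
      assume "F i m \<noteq> m + bR"
      then have i: "F i m = m + bL" "bL < bR" using opt_i[OF less.prems(2)] b by auto
      show False
      proof (cases "m < \<beta> + (bR - bL)")
        case True
        then have "m + bL - \<beta> < u" "bL \<le> m + bL - \<beta>" "m + bL - \<beta> < bR" "m + bL - \<beta> + \<beta> = m + bL"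
          using less.prems b by auto
        then have "F j (m + bL - \<beta>) = m + bL" "m + bL - \<beta> < u"
          using j_eq[of "m + bL - \<beta>"] by auto
        then show False using placement_injD[of i m j "m + bL - \<beta>"] i less.prems distinct_roles by auto
      next
        case False
        define m' where "m' = m - (bR - bL)"
        have m': "\<beta> \<le> m'" "m' < m" "m' + bR = m + bL"
          using False i by (auto simp: m'_def)
        then have "F i m' = m + bL"
          using less.IH[of m'] less.prems by auto
        then show False using placement_injD[of i m i m'] i less.prems m' by auto
      qed
    qed
  qed
  show "F k m = (if m < bL then m else if bR \<le> m then m + u else 2 * u + m)"
    and "F j m = (if bL \<le> m \<and> m < bR then m + \<beta> else 2 * u + m)"
    and "F i m = (if m < \<beta> then m + bL else m + bR)"
    using k_eq j_eq i_low i_high m by auto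
qed

text \<open>The exponent with \<open>e\<^sub>i = \<beta>\<close> and \<open>e\<^sub>j = u - \<alpha>\<close>. Again block \<open>k\<close> has to fill the columns below
  \<open>\<beta>\<close> and from \<open>u + \<alpha>\<close> on, and its other rows are in extra columns. Row \<open>(j, m)\<close> and row
  \<open>(i, m - (\<alpha> - \<beta>))\<close> compete for the same column; following this chain in steps of \<open>\<alpha> - \<beta>\<close>
  from the left settles all rows with \<open>m < \<alpha>\<close>, and the count for \<open>j\<close> settles the others.\<close>

lemma inner_placement_unique:
  assumes Si: "S i \<subseteq> {\<alpha>}" and Sj: "S j \<subseteq> {\<beta>}" and Sk: "S k \<subseteq> {0, u}"
    and b: "\<beta> < \<alpha>" "\<alpha> \<le> u"
    and num: "num_ext u F i = \<beta>" "num_ext u F j = u - \<alpha>" "num_ext u F k = \<alpha> - \<beta>"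
    and m: "m < u"
  shows "F k m = (if m < \<beta> then m else if \<alpha> \<le> m then m + u else 2 * u + m)"
    and "F j m = (if m < \<alpha> then m + \<beta> else 2 * u + m)"
    and "F i m = (if m < \<beta> then 2 * u + m else m + \<alpha>)"
proof -
  have opt_i: "F i m = m + \<alpha> \<or> F i m = 2 * u + m" if "m < u" for m
    using placement_cases[of i m] that Si by auto
  have opt_j: "F j m = m + \<beta> \<or> F j m = 2 * u + m" if "m < u" for m
    using placement_cases[of j m] that Sj by auto
  have opt_k: "F k m = m \<or> F k m = m + u \<or> F k m = 2 * u + m" if "m < u" for m
    using placement_cases[of k m] that Sk by auto
  have low: "F k m = m" if "m < \<beta>" for m
  proof -
    have "m < u" using that b by simp
    then obtain m' where m': "m' < u" "F i m' = m \<or> F j m' = m \<or> F k m' = m"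
      using column_covered[of m] by auto
    then show ?thesis using opt_i[OF m'(1)] opt_j[OF m'(1)] opt_k[OF m'(1)] that b by auto
  qed
  have high: "F k m = m + u" if "\<alpha> \<le> m" "m < u" for m
  proof -
    have "m + u < 3 * u" using that by simp
    then obtain m' where m': "m' < u" "F i m' = m + u \<or> F j m' = m + u \<or> F k m' = m + u"
      by (rule column_covered)
    then show ?thesis using opt_i[OF m'(1)] opt_j[OF m'(1)] opt_k[OF m'(1)] that b by auto
  qed
  have "{m. m < u \<and> F k m = 2 * u + m} = {\<beta>..<\<alpha>}"
  proof (rule ext_set_eqI')
    have "F k m \<noteq> 2 * u + m" if "m < u" "m < \<beta> \<or> \<alpha> \<le> m" for m
      using low[of m] high[of m] that by auto
    then show "{m. m < u \<and> F k m = 2 * u + m} \<subseteq> {\<beta>..<\<alpha>}" by force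
  qed (use num(3) in auto)
  then have k_ext: "F k m = 2 * u + m \<longleftrightarrow> \<beta> \<le> m \<and> m < \<alpha>" if "m < u" for m
    using that by (auto simp: set_eq_iff)
  have k_eq: "F k m = (if m < \<beta> then m else if \<alpha> \<le> m then m + u else 2 * u + m)" if "m < u" for m
    using low high k_ext[OF that] that by auto
  have mid: "F i m = m + \<alpha>" "F j m = m + \<beta>" if "\<beta> \<le> m" "m < \<alpha>" for m
    using not_two_ext[of m] k_ext[of m] opt_i[of m] opt_j[of m] that b by auto
  have j_low: "F j m = m + \<beta>" if "m < \<alpha>" for m
    using that
  proof (induction m rule: less_induct)
    case (less m)
    show ?case
    proof (cases "\<beta> \<le> m")
      case True
      then show ?thesis using mid less.prems by auto
    next
      case False
      then obtain m' where m': "m' < u" "F i m' = m + \<beta> \<or> F j m' = m + \<beta> \<or> F k m' = m + \<beta>"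
        using column_covered[of "m + \<beta>"] b by auto
      have "F k m' \<noteq> m + \<beta>" using k_eq[OF m'(1)] False b m'(1) by auto
      moreover have "F i m' \<noteq> m + \<beta>"
      proof
        assume i: "F i m' = m + \<beta>"
        then have i': "F i m' = m' + \<alpha>" using opt_i[OF m'(1)] False b by auto
        then have "m' < m" "m' < \<beta>" using i False b by auto
        then have "F j m' = m' + \<beta>" using less.IH[of m'] less.prems by auto
        then show False using one_ext[OF m'(1)] i' low[OF \<open>m' < \<beta>\<close>] b m' by auto
      qed
      ultimately show ?thesis using m' opt_j[OF m'(1)] False b by auto
    qed
  qed
  have "{m. m < u \<and> F j m = 2 * u + m} = {\<alpha>..<u}"
  proof (rule ext_set_eqI')
    have "F j m \<noteq> 2 * u + m" if "m < u" "m < \<alpha>" for m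
      using j_low[of m] that b by auto
    then show "{m. m < u \<and> F j m = 2 * u + m} \<subseteq> {\<alpha>..<u}" by force
  qed (use num(2) in auto)
  then have j_high: "F j m = 2 * u + m" if "m < u" "\<alpha> \<le> m" for m
    using that by (auto simp: set_eq_iff)
  have i_eq: "F i m = (if m < \<beta> then 2 * u + m else m + \<alpha>)" if "m < u" for m
  proof -
    consider "m < \<beta>" | "\<beta> \<le> m" "m < \<alpha>" | "\<alpha> \<le> m" by linarith
    then show ?thesis
    proof cases
      case 1
      then show ?thesis using one_ext[OF that] low[of m] j_low[of m] b that by auto
    next
      case 2
      then show ?thesis using mid by auto
    next
      case 3
      then show ?thesis using not_two_ext[OF that] j_high[of m] opt_i[OF that] b that by auto
    qed
  qed
  show "F k m = (if m < \<beta> then m else if \<alpha> \<le> m then m + u else 2 * u + m)"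
    and "F j m = (if m < \<alpha> then m + \<beta> else 2 * u + m)"
    and "F i m = (if m < \<beta> then 2 * u + m else m + \<alpha>)"
    using k_eq j_low j_high i_eq m by auto
qed

end

text \<open>Counting makes surjectivity onto the \<open>3 u\<close> columns automatic.\<close>

lemma placementI:
  assumes roles: "{i, j, k} = {0, 1, 2::nat}"
    and ok: "\<And>r m. r \<in> {i, j, k} \<Longrightarrow> m < u \<Longrightarrow> F r m = 2 * u + m \<or> (m \<le> F r m \<and> F r m - m \<in> S r \<and> F r m \<le> m + u)"
    and inj: "\<And>m m'. m < u \<Longrightarrow> m' < u \<Longrightarrow> F i m \<noteq> F j m' \<and> F i m \<noteq> F k m' \<and> F j m \<noteq> F k m'"
    and inj': "\<And>r m m'. r \<in> {i, j, k} \<Longrightarrow> m < m' \<Longrightarrow> m' < u \<Longrightarrow> F r m \<noteq> F r m'"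
  shows "placement u S F"
proof -
  let ?f = "\<lambda>(r, m). F r m" and ?A = "{i, j, k} \<times> {..<u}"
  have "F r m < 3 * u" if "r \<in> {i, j, k}" "m < u" for r m
    using ok[OF that] that by linarith
  then have sub: "?f ` ?A \<subseteq> {..<3 * u}" by auto
  have *: "r = r' \<and> m = m'"
    if e: "F r m = F r' m'" and r: "r \<in> {i, j, k}" "r' \<in> {i, j, k}" and m: "m < u" "m' < u" for r m r' m'
  proof -
    have "r = r'"
      using r e inj[OF m] inj[OF m(2,1)] by (elim insertE emptyE) simp_all
    moreover have "\<not> m < m'" "\<not> m' < m"
      using inj'[OF r(1)] e m \<open>r = r'\<close> by metis+
    ultimately show ?thesis by simp
  qed
  have inj_f: "inj_on ?f ?A"
  proof (rule inj_onI)
    fix x y assume "x \<in> ?A" "y \<in> ?A" "?f x = ?f y"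
    then show "x = y"
      using *[of "fst x" "snd x" "fst y" "snd y"] by (cases x; cases y) simp
  qed
  have "card (?f ` ?A) = card ?A" using inj_f by (rule card_image)
  also have "\<dots> = 3 * u" using roles by simp
  finally have "?f ` ?A = {..<3 * u}" using sub by (intro card_subset_eq) auto
  moreover have "\<exists>s\<in>S r. s \<le> u \<and> F r m = m + s"
    if "r \<in> {i, j, k}" "m < u" "F r m \<noteq> 2 * u + m" for r m
    using ok[OF that(1,2)] that(3) by (intro bexI[of _ "F r m - m"]) auto
  ultimately show ?thesis
    using inj_f unfolding placement_def bij_betw_def roles by blast
qed

text \<open>The placement forced by \<open>edge_placement_unique\<close>. Block \<open>k\<close> uses the exponent 0 only if \<open>bL > 0\<close>,
  and \<open>u\<close> only if \<open>bR < u\<close>; so with \<open>bL = bR \<in> {0, u}\<close> this also covers vertices for which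
  no single support contains both 0 and \<open>u\<close>.\<close>

lemma edge_placement_exists:
  assumes roles: "{i, j, k} = {0, 1, 2::nat}"
    and S: "bL \<in> S i" "bR \<in> S i" "\<beta> \<in> S j" "0 < bL \<Longrightarrow> 0 \<in> S k" "bR < u \<Longrightarrow> u \<in> S k"
    and b: "bL \<le> bR" "bR \<le> u" "\<beta> \<le> u"
  shows "\<exists>F. placement u S F \<and> num_ext u F i = 0 \<and> num_ext u F j = u - (bR - bL) \<and> num_ext u F k = bR - bL"
proof -
  define F where "F = (\<lambda>r m. if r = i then (if m < \<beta> then m + bL else m + bR)
     else if r = j then (if bL \<le> m \<and> m < bR then m + \<beta> else 2 * u + m)
     else (if m < bL then m else if bR \<le> m then m + u else 2 * u + m))"
  note d = roles_distinct[OF roles]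
  have Fi: "F i m = (if m < \<beta> then m + bL else m + bR)"
    and Fj: "F j m = (if bL \<le> m \<and> m < bR then m + \<beta> else 2 * u + m)"
    and Fk: "F k m = (if m < bL then m else if bR \<le> m then m + u else 2 * u + m)" for m
    using d by (auto simp: F_def)
  have "placement u S F"
  proof (rule placementI[OF roles])
    fix r m assume "r \<in> {i, j, k}" "m < u"
    then show "F r m = 2 * u + m \<or> (m \<le> F r m \<and> F r m - m \<in> S r \<and> F r m \<le> m + u)"
      using S b by (auto simp: Fi Fj Fk split: if_splits)
  next
    fix m m' assume "m < u" "m' < u"
    then show "F i m \<noteq> F j m' \<and> F i m \<noteq> F k m' \<and> F j m \<noteq> F k m'"
      using b by (auto simp: Fi Fj Fk)
  next
    fix r m m' assume "r \<in> {i, j, k}" "m < m'" "m' < u"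
    then show "F r m \<noteq> F r m'"
      using b by (auto simp: Fi Fj Fk split: if_splits)
  qed
  moreover have "{m. m < u \<and> F i m = 2 * u + m} = {}"
    using b by (auto simp: Fi split: if_splits)
  moreover have "{m. m < u \<and> F j m = 2 * u + m} = {..<bL} \<union> {bR..<u}"
    using b by (auto simp: Fj split: if_splits)
  moreover have "{m. m < u \<and> F k m = 2 * u + m} = {bL..<bR}"
    using b by (auto simp: Fk split: if_splits)
  moreover have "card ({..<bL} \<union> {bR..<u}) = card {..<bL} + card {bR..<u}"
    using b by (intro card_Un_disjoint) auto
  ultimately show ?thesis
    unfolding num_ext_def using b by (intro exI[of _ F]) auto
qed

lemma inner_placement_exists:
  assumes roles: "{i, j, k} = {0, 1, 2::nat}"
    and S: "\<alpha> \<in> S i" "\<beta> \<in> S j" "0 \<in> S k" "u \<in> S k"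
    and b: "\<beta> < \<alpha>" "\<alpha> \<le> u"
  shows "\<exists>F. placement u S F \<and> num_ext u F i = \<beta> \<and> num_ext u F j = u - \<alpha> \<and> num_ext u F k = \<alpha> - \<beta>"
proof -
  define F where "F = (\<lambda>r m. if r = i then (if m < \<beta> then 2 * u + m else m + \<alpha>)
     else if r = j then (if m < \<alpha> then m + \<beta> else 2 * u + m)
     else (if m < \<beta> then m else if \<alpha> \<le> m then m + u else 2 * u + m))"
  note d = roles_distinct[OF roles]
  have Fi: "F i m = (if m < \<beta> then 2 * u + m else m + \<alpha>)"
    and Fj: "F j m = (if m < \<alpha> then m + \<beta> else 2 * u + m)"
    and Fk: "F k m = (if m < \<beta> then m else if \<alpha> \<le> m then m + u else 2 * u + m)" for m
    using d by (auto simp: F_def)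
  have "placement u S F"
  proof (rule placementI[OF roles])
    fix r m assume "r \<in> {i, j, k}" "m < u"
    then show "F r m = 2 * u + m \<or> (m \<le> F r m \<and> F r m - m \<in> S r \<and> F r m \<le> m + u)"
      using S b by (auto simp: Fi Fj Fk split: if_splits)
  next
    fix m m' assume "m < u" "m' < u"
    then show "F i m \<noteq> F j m' \<and> F i m \<noteq> F k m' \<and> F j m \<noteq> F k m'"
      using b by (auto simp: Fi Fj Fk)
  next
    fix r m m' assume "r \<in> {i, j, k}" "m < m'" "m' < u"
    then show "F r m \<noteq> F r m'"
      using b by (auto simp: Fi Fj Fk split: if_splits)
  qed
  moreover have "{m. m < u \<and> F i m = 2 * u + m} = {..<\<beta>}"
    using b by (auto simp: Fi split: if_splits)
  moreover have "{m. m < u \<and> F j m = 2 * u + m} = {\<alpha>..<u}"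
    using b by (auto simp: Fj split: if_splits)
  moreover have "{m. m < u \<and> F k m = 2 * u + m} = {\<beta>..<\<alpha>}"
    using b by (auto simp: Fk split: if_splits)
  ultimately show ?thesis
    unfolding num_ext_def using b by (intro exI[of _ F]) auto
qed

section \<open>A weighted bound on placements\<close>

lemma sum_min_shift:
  fixes p p' u :: nat
  assumes "p' \<le> u"
  shows "(\<Sum>m<u. min (m + p) (p + p')) = (\<Sum>m<p'. m + p) + (u - p') * (p + p')"
proof -
  have "(\<Sum>m<u. min (m + p) (p + p')) = (\<Sum>m<p'. min (m + p) (p + p')) + (\<Sum>m=p'..<u. min (m + p) (p + p'))"
    unfolding lessThan_atLeast0 using assms by (intro sum.atLeastLessThan_concat[symmetric]) auto
  also have "(\<Sum>m<p'. min (m + p) (p + p')) = (\<Sum>m<p'. m + p)"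
    by (intro sum.cong) auto
  also have "(\<Sum>m=p'..<u. min (m + p) (p + p')) = (\<Sum>m=p'..<u. p + p')"
    by (intro sum.cong) auto
  finally show ?thesis by simp
qed

text \<open>The surplus \<open>p * p'\<close> of the row potentials over the column potentials; \<open>min _ (p + p')\<close> is the
  potential.\<close>

lemma sum_min_balance:
  fixes p p' u :: nat
  assumes "p \<le> u" "p' \<le> u"
  shows "(\<Sum>m<u. min (m + p) (p + p')) + (\<Sum>m<u. min (m + p') (p + p'))
    = (\<Sum>l<2 * u. min l (p + p')) + p * p'"
proof -
  have 1: "(\<Sum>l<2 * u. min l (p + p')) = (\<Sum>l<p + p'. l) + (2 * u - (p + p')) * (p + p')"
    using sum_min_shift[of "p + p'" "2 * u" 0] assms by simp
  have "(\<Sum>l<p + p'. l) = (\<Sum>l<p. l) + (\<Sum>l=p..<p + p'. l)"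
    unfolding lessThan_atLeast0 by (intro sum.atLeastLessThan_concat[symmetric]) auto
  also have "(\<Sum>l=p..<p + p'. l) = (\<Sum>m<p'. m + p)"
    using sum.shift_bounds_nat_ivl[of "\<lambda>l. l" 0 p p'] by (simp add: lessThan_atLeast0 add.commute)
  finally have 2: "(\<Sum>l<p + p'. l) = (\<Sum>l<p. l) + (\<Sum>m<p'. m + p)" .
  have 3: "(\<Sum>m<p. m + p') = (\<Sum>l<p. l) + p * p'"
    by (simp add: sum.distrib)
  have 4: "(u - p') * (p + p') + (u - p) * (p + p') = (2 * u - (p + p')) * (p + p')"
    unfolding add_mult_distrib[symmetric] using assms by (intro arg_cong2[of _ _ _ _ "(*)"]) auto
  have "(\<Sum>m<u. min (m + p') (p + p')) = (\<Sum>m<p. m + p') + (u - p) * (p + p')"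
    using sum_min_shift[of p u p'] assms by (simp add: add.commute)
  with sum_min_shift[OF assms(2), of p] 1 2 3 4 show ?thesis by linarith
qed

context placement_roles
begin

lemma sum_over_columns:
  fixes G :: "nat \<Rightarrow> real"
  shows "(\<Sum>m<u. G (F i m)) + (\<Sum>m<u. G (F j m)) + (\<Sum>m<u. G (F k m)) = (\<Sum>c<3 * u. G c)"
proof -
  have "(\<Sum>c<3 * u. G c) = (\<Sum>x\<in>{i, j, k} \<times> {..<u}. G (case x of (r, m) \<Rightarrow> F r m))"
    using placement unfolding placement_def roles by (intro sum.reindex_bij_betw[symmetric]) blast
  also have "\<dots> = (\<Sum>r\<in>{i, j, k}. \<Sum>m<u. G (F r m))"
    by (simp add: sum.cartesian_product split_def)
  finally show ?thesis using distinct_roles by (simp add: add.assoc)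
qed

lemma sum_if_ext: "(\<Sum>m<u. if F r m = 2 * u + m then w else 0) = (w::real) * num_ext u F r"
proof -
  have "(\<Sum>m<u. if F r m = 2 * u + m then w else 0) = (\<Sum>m\<in>{m\<in>{..<u}. F r m = 2 * u + m}. w)"
    by (intro sum.inter_filter[symmetric]) simp
  then show ?thesis unfolding num_ext_def by simp
qed

text \<open>Weak duality for the assignment problem. Column \<open>l < 2 u\<close> has the potential \<open>g l\<close>, which grows
  with slope \<open>\<mu>\<close> at the left end, falls with slope \<open>\<kappa>\<close> at the right end and is constant in between;
  a row of block \<open>i\<close> or \<open>j\<close> has a potential \<open>h\<close> that does not exceed \<open>g\<close> on the columns available
  to it. Row \<open>(k, m)\<close> and the extra column \<open>2 u + m\<close> share the potential \<open>hk m\<close>. Summing over all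
  rows makes the potentials cancel up to the left-hand side of the claim.

  Geometrically \<open>ai\<close>, \<open>aj\<close> are the orders of vanishing of \<open>P\<^sub>i\<close>, \<open>P\<^sub>j\<close> at \<open>t = 0\<close> and \<open>zi\<close>, \<open>zj\<close> those at
  \<open>t = \<infinity>\<close>, and the two products are the contributions of these two points to the bound.\<close>

lemma weight_bound:
  fixes \<mu> \<kappa> wi wj :: real and ai aj zi zj :: nat
  assumes Si: "S i \<subseteq> {ai..u - zi}" and Sj: "S j \<subseteq> {aj..u - zj}"
    and pq: "ai + zi \<le> u" "aj + zj \<le> u"
    and \<mu>: "0 \<le> \<mu>" "\<mu> * ai \<le> wi" "\<mu> * aj \<le> wj"
    and \<kappa>: "0 \<le> \<kappa>" "\<kappa> * zi \<le> wi" "\<kappa> * zj \<le> wj"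
  shows "\<mu> * (ai * aj) + \<kappa> * (zi * zj) \<le> wi * num_ext u F i + wj * num_ext u F j"
proof -
  define g1 :: "nat \<Rightarrow> real" where "g1 l = real (min l (ai + aj))" for l
  define g2 :: "nat \<Rightarrow> real" where "g2 l = real (min l (zi + zj))" for l
  define g where "g l = \<mu> * g1 l + \<kappa> * g2 (2 * u - 1 - l)" for l
  define h where "h p q m = \<mu> * g1 (m + p) + \<kappa> * g2 (u - 1 - m + q)" for p q m
  define hk where "hk m = max (h ai zi m - wi) (h aj zj m - wj)" for m
  define G where "G c = (if c < 2 * u then g c else hk (c - 2 * u))" for c
  have tight: "h p q m \<le> g (m + s)" if "p \<le> s" "s + q \<le> u" "m < u" for p q m s
  proof -
    have "g1 (m + p) \<le> g1 (m + s)" using that by (auto simp: g1_def)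
    moreover have "g2 (u - 1 - m + q) \<le> g2 (2 * u - 1 - (m + s))" using that by (auto simp: g2_def)
    ultimately show ?thesis
      unfolding h_def g_def using \<mu>(1) \<kappa>(1) by (intro add_mono mult_left_mono) auto
  qed
  \<comment> \<open>of the two ends of the potential at most one costs anything here, since \<open>p + q \<le> u\<close>\<close>
  have loose: "h p q m - w \<le> g (m + s)"
    if "p + q \<le> u" "\<mu> * p \<le> w" "\<kappa> * q \<le> w" "s \<le> u" "m < u" for p q m s w
  proof (cases "s < p")
    case True
    have "g1 (m + p) \<le> g1 (m + s) + real p" by (auto simp: g1_def)
    moreover have "g2 (u - 1 - m + q) \<le> g2 (2 * u - 1 - (m + s))"
      using that True by (auto simp: g2_def)
    ultimately have "h p q m \<le> \<mu> * (g1 (m + s) + real p) + \<kappa> * g2 (2 * u - 1 - (m + s))"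
      unfolding h_def using \<mu>(1) \<kappa>(1) by (intro add_mono mult_left_mono) auto
    then show ?thesis using that by (simp add: g_def algebra_simps)
  next
    case False
    have "g1 (m + p) \<le> g1 (m + s)" using False by (auto simp: g1_def)
    moreover have "g2 (u - 1 - m + q) \<le> g2 (2 * u - 1 - (m + s)) + real q"
      using that by (auto simp: g2_def)
    ultimately have "h p q m \<le> \<mu> * g1 (m + s) + \<kappa> * (g2 (2 * u - 1 - (m + s)) + real q)"
      unfolding h_def using \<mu>(1) \<kappa>(1) by (intro add_mono mult_left_mono) auto
    then show ?thesis using that by (simp add: g_def algebra_simps)
  qed
  have row_i: "h ai zi m \<le> G (F i m) + (if F i m = 2 * u + m then wi else 0)" if "m < u" for m
  proof (cases "F i m = 2 * u + m")
    case True
    then show ?thesis by (simp add: G_def hk_def)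
  next
    case False
    then obtain s where "s \<in> S i" "s \<le> u" "F i m = m + s" using placement_cases[of i m] \<open>m < u\<close> by auto
    moreover have "ai \<le> s" "s + zi \<le> u" using subsetD[OF Si \<open>s \<in> S i\<close>] pq by auto
    ultimately show ?thesis using tight[of ai s zi m] False that by (simp add: G_def)
  qed
  have row_j: "h aj zj m \<le> G (F j m) + (if F j m = 2 * u + m then wj else 0)" if "m < u" for m
  proof (cases "F j m = 2 * u + m")
    case True
    then show ?thesis by (simp add: G_def hk_def)
  next
    case False
    then obtain s where "s \<in> S j" "s \<le> u" "F j m = m + s" using placement_cases[of j m] \<open>m < u\<close> by auto
    moreover have "aj \<le> s" "s + zj \<le> u" using subsetD[OF Sj \<open>s \<in> S j\<close>] pq by auto
    ultimately show ?thesis using tight[of aj s zj m] False that by (simp add: G_def)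
  qed
  have row_k: "hk m \<le> G (F k m)" if "m < u" for m
  proof (cases "F k m = 2 * u + m")
    case True
    then show ?thesis by (simp add: G_def)
  next
    case False
    then obtain s where "s \<le> u" "F k m = m + s" using placement_cases[of k m] \<open>m < u\<close> by auto
    then show ?thesis
      using loose[of ai zi wi s m] loose[of aj zj wj s m] pq \<mu> \<kappa> that
      by (simp add: G_def hk_def)
  qed
  have "(\<Sum>m<u. h ai zi m) \<le> (\<Sum>m<u. G (F i m)) + wi * num_ext u F i"
    unfolding sum_if_ext[symmetric] sum.distrib[symmetric] using row_i by (intro sum_mono) auto
  moreover have "(\<Sum>m<u. h aj zj m) \<le> (\<Sum>m<u. G (F j m)) + wj * num_ext u F j"
    unfolding sum_if_ext[symmetric] sum.distrib[symmetric] using row_j by (intro sum_mono) auto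
  moreover have "(\<Sum>m<u. hk m) \<le> (\<Sum>m<u. G (F k m))"
    using row_k by (intro sum_mono) auto
  moreover have "(\<Sum>c<3 * u. G c) = (\<Sum>l<2 * u. g l) + (\<Sum>m<u. hk m)"
  proof -
    have "(\<Sum>c<3 * u. G c) = (\<Sum>c<2 * u. G c) + (\<Sum>c=2 * u..<3 * u. G c)"
      unfolding lessThan_atLeast0 by (intro sum.atLeastLessThan_concat[symmetric]) auto
    moreover have "(\<Sum>c<2 * u. G c) = (\<Sum>l<2 * u. g l)" by (simp add: G_def)
    moreover have "(\<Sum>c=2 * u..<3 * u. G c) = (\<Sum>m=0..<u. G (m + 2 * u))"
      using sum.shift_bounds_nat_ivl[of G 0 "2 * u" u] by (simp add: numeral_3_eq_3)
    moreover have "(\<Sum>m=0..<u. G (m + 2 * u)) = (\<Sum>m<u. hk m)"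
      by (simp add: G_def lessThan_atLeast0)
    ultimately show ?thesis by simp
  qed
  moreover have "(\<Sum>m<u. h ai zi m) + (\<Sum>m<u. h aj zj m) = (\<Sum>l<2 * u. g l) + (\<mu> * (ai * aj) + \<kappa> * (zi * zj))"
  proof -
    have a: "(\<Sum>m<u. g1 (m + ai)) + (\<Sum>m<u. g1 (m + aj)) = (\<Sum>l<2 * u. g1 l) + ai * aj"
      using arg_cong[OF sum_min_balance[of ai u aj], of real] pq by (simp add: g1_def)
    have b: "(\<Sum>m<u. g2 (m + zi)) + (\<Sum>m<u. g2 (m + zj)) = (\<Sum>l<2 * u. g2 l) + zi * zj"
      using arg_cong[OF sum_min_balance[of zi u zj], of real] pq by (simp add: g2_def)
    have rev: "(\<Sum>m<u. g2 (u - 1 - m + q)) = (\<Sum>m<u. g2 (m + q))" for q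
      using sum.nat_diff_reindex[of "\<lambda>m. g2 (m + q)" u] by simp
    have rev': "(\<Sum>l<2 * u. g2 (2 * u - 1 - l)) = (\<Sum>l<2 * u. g2 l)"
      using sum.nat_diff_reindex[of g2 "2 * u"] by simp
    have "(\<Sum>m<u. h ai zi m) + (\<Sum>m<u. h aj zj m)
        = \<mu> * ((\<Sum>m<u. g1 (m + ai)) + (\<Sum>m<u. g1 (m + aj)))
        + \<kappa> * ((\<Sum>m<u. g2 (m + zi)) + (\<Sum>m<u. g2 (m + zj)))"
      unfolding h_def sum.distrib sum_distrib_left[symmetric] rev by (simp add: algebra_simps)
    also have "\<dots> = (\<Sum>l<2 * u. g l) + (\<mu> * (ai * aj) + \<kappa> * (zi * zj))"
      unfolding a b g_def sum.distrib sum_distrib_left[symmetric] rev' by (simp add: algebra_simps)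
    finally show ?thesis .
  qed
  ultimately show ?thesis using sum_over_columns[of G] by linarith
qed

lemma sum_num_ext: "num_ext u F i + num_ext u F j + num_ext u F k = u"
proof -
  let ?E = "\<lambda>r. {m. m < u \<and> F r m = 2 * u + m}"
  have "{..<u} = (?E i \<union> ?E j) \<union> ?E k"
    using one_ext by auto
  then have "u = card ((?E i \<union> ?E j) \<union> ?E k)" by (metis card_lessThan)
  also have "\<dots> = card (?E i \<union> ?E j) + card (?E k)"
    using not_two_ext by (intro card_Un_disjoint) auto
  also have "card (?E i \<union> ?E j) = card (?E i) + card (?E j)"
    using not_two_ext by (intro card_Un_disjoint) auto
  finally show ?thesis unfolding num_ext_def by simp
qed

end

section \<open>The implicit determinant\<close>

text \<open>Row \<open>(r, m)\<close> has the index \<open>3 * m + r\<close>, so that \<open>div\<close> and \<open>mod\<close> recover \<open>m\<close> and \<open>r\<close> independently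
  of \<open>u\<close>. The entry in an extra column is stored as 1; the variable is supplied separately.\<close>

definition entry :: "(nat \<Rightarrow> complex poly) \<Rightarrow> nat \<Rightarrow> nat \<Rightarrow> nat \<Rightarrow> complex" where
  "entry P u a b =
     (if b < 2 * u then if a div 3 \<le> b then coeff (P (a mod 3)) (b - a div 3) else 0
      else if b = 2 * u + a div 3 then 1 else 0)"

definition mono2 :: "complex \<Rightarrow> nat \<Rightarrow> nat \<Rightarrow> complex poly poly" where
  "mono2 a m n = monom (monom a m) n"

text \<open>The entries in the extra columns are \<open>x\<close>, \<open>y\<close> and 1 for the blocks 0, 1 and 2, that is, the
  homogeneous matrix at \<open>x\<^sub>2 = 1\<close>.\<close>

definition implicit_matrix :: "(nat \<Rightarrow> complex poly) \<Rightarrow> nat \<Rightarrow> complex poly poly mat" where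
  "implicit_matrix P u = Matrix.mat (3 * u) (3 * u) (\<lambda>(a, b).
     mono2 (entry P u a b) (of_bool (2 * u \<le> b \<and> a mod 3 = 0)) (of_bool (2 * u \<le> b \<and> a mod 3 = 1)))"

definition implicit_det :: "(nat \<Rightarrow> complex poly) \<Rightarrow> nat \<Rightarrow> complex poly poly" where
  "implicit_det P u = Determinant.det (implicit_matrix P u)"

definition perm_ext :: "nat \<Rightarrow> (nat \<Rightarrow> nat) \<Rightarrow> nat \<Rightarrow> nat" where
  "perm_ext u \<sigma> r = card {a. a < 3 * u \<and> 2 * u \<le> \<sigma> a \<and> a mod 3 = r}"

lemma mono2_mult: "mono2 a m n * mono2 b m' n' = mono2 (a * b) (m + m') (n + n')"
  by (simp add: mono2_def mult_monom)

lemma mono2_prod: "finite A \<Longrightarrow> (\<Prod>a\<in>A. mono2 (f a) (g a) (h a)) = mono2 (prod f A) (sum g A) (sum h A)"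
proof (induction A rule: finite_induct)
  case empty
  show ?case by (simp add: mono2_def monom_0 one_pCons)
next
  case (insert x F)
  then show ?case by (simp add: mono2_mult)
qed

lemma coeff_mono2: "coeff (coeff (mono2 a m n) n') m' = (if m = m' \<and> n = n' then a else 0)"
  by (simp add: mono2_def coeff_monom)

lemma signof_mono2: "signof \<sigma> = mono2 (signof \<sigma>) 0 0"
  by (simp add: mono2_def monom_0 one_pCons sign_def)

lemma coeff_implicit_det:
  "coeff (coeff (implicit_det P u) n) m =
     (\<Sum>\<sigma> | \<sigma> permutes {0..<3 * u}. if perm_ext u \<sigma> 0 = m \<and> perm_ext u \<sigma> 1 = n
        then signof \<sigma> * (\<Prod>a=0..<3 * u. entry P u a (\<sigma> a)) else 0)"
proof -
  have "implicit_det P u = (\<Sum>\<sigma> | \<sigma> permutes {0..<3 * u}.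
      signof \<sigma> * (\<Prod>a=0..<3 * u. implicit_matrix P u $$ (a, \<sigma> a)))"
    unfolding implicit_det_def by (rule det_def') (simp add: implicit_matrix_def)
  also have "\<dots> = (\<Sum>\<sigma> | \<sigma> permutes {0..<3 * u}.
      mono2 (signof \<sigma> * (\<Prod>a=0..<3 * u. entry P u a (\<sigma> a))) (perm_ext u \<sigma> 0) (perm_ext u \<sigma> 1))"
  proof (rule sum.cong[OF refl])
    fix \<sigma> assume "\<sigma> \<in> {\<sigma>. \<sigma> permutes {0..<3 * u}}"
    then have \<sigma>: "\<sigma> a < 3 * u" if "a < 3 * u" for a
      using that permutes_in_image[of \<sigma> "{0..<3 * u}" a] by auto
    have ext: "(\<Sum>a=0..<3 * u. of_bool (2 * u \<le> \<sigma> a \<and> a mod 3 = r)) = perm_ext u \<sigma> r" for r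
    proof -
      have "{0..<3 * u} \<inter> {a. 2 * u \<le> \<sigma> a \<and> a mod 3 = r} = {a. a < 3 * u \<and> 2 * u \<le> \<sigma> a \<and> a mod 3 = r}"
        by auto
      then show ?thesis unfolding perm_ext_def by simp
    qed
    have "(\<Prod>a=0..<3 * u. implicit_matrix P u $$ (a, \<sigma> a))
      = (\<Prod>a=0..<3 * u. mono2 (entry P u a (\<sigma> a))
          (of_bool (2 * u \<le> \<sigma> a \<and> a mod 3 = 0)) (of_bool (2 * u \<le> \<sigma> a \<and> a mod 3 = 1)))"
      by (intro prod.cong) (auto simp: implicit_matrix_def \<sigma>)
    also have "\<dots> = mono2 (\<Prod>a=0..<3 * u. entry P u a (\<sigma> a))
        (\<Sum>a=0..<3 * u. of_bool (2 * u \<le> \<sigma> a \<and> a mod 3 = 0))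
        (\<Sum>a=0..<3 * u. of_bool (2 * u \<le> \<sigma> a \<and> a mod 3 = 1))"
      by (rule mono2_prod) simp
    also have "\<dots> = mono2 (\<Prod>a=0..<3 * u. entry P u a (\<sigma> a)) (perm_ext u \<sigma> 0) (perm_ext u \<sigma> 1)"
      unfolding ext ..
    finally show "signof \<sigma> * (\<Prod>a=0..<3 * u. implicit_matrix P u $$ (a, \<sigma> a))
      = mono2 (signof \<sigma> * (\<Prod>a=0..<3 * u. entry P u a (\<sigma> a))) (perm_ext u \<sigma> 0) (perm_ext u \<sigma> 1)"
      by (subst signof_mono2) (simp add: mono2_mult)
  qed
  finally show ?thesis
    by (simp add: coeff_sum coeff_mono2)
qed

lemma eval2_hom: "comm_ring_hom (\<lambda>f. eval2 f x y)"
  by unfold_locales (simp_all add: eval2_def)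

lemma eval2_mono2: "eval2 (mono2 a m n) x y = a * x ^ m * y ^ n"
  by (simp add: eval2_def mono2_def poly_monom)

lemma eval2_implicit_det:
  "eval2 (implicit_det P u) x y = Determinant.det (Matrix.mat (3 * u) (3 * u) (\<lambda>(a, b).
     entry P u a b * x ^ of_bool (2 * u \<le> b \<and> a mod 3 = 0) * y ^ of_bool (2 * u \<le> b \<and> a mod 3 = 1)))"
proof -
  interpret comm_ring_hom "\<lambda>f. eval2 f x y" by (rule eval2_hom)
  show ?thesis unfolding implicit_det_def
    by (subst hom_det[symmetric])
      (intro arg_cong[of _ _ Determinant.det] eq_matI, auto simp: implicit_matrix_def eval2_mono2)
qed

lemma sum_shifted_coeffs:
  fixes p :: "complex poly"
  assumes "degree p \<le> u" "m < u"
  shows "(\<Sum>b<2 * u. (if m \<le> b then coeff p (b - m) else 0) * t ^ b) = t ^ m * poly p t"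
proof -
  have "(\<Sum>b<2 * u. (if m \<le> b then coeff p (b - m) else 0) * t ^ b)
      = (\<Sum>b\<in>{m..m + u}. coeff p (b - m) * t ^ b)"
  proof (rule sum.mono_neutral_cong_right)
    show "\<forall>b\<in>{..<2 * u} - {m..m + u}. (if m \<le> b then coeff p (b - m) else 0) * t ^ b = 0"
      using assms by (auto intro!: coeff_eq_0)
  qed (use assms in auto)
  also have "\<dots> = (\<Sum>s\<le>u. coeff p s * t ^ (m + s))"
    by (rule sum.reindex_bij_witness[of _ "\<lambda>s. m + s" "\<lambda>b. b - m"]) auto
  also have "\<dots> = t ^ m * (\<Sum>s\<le>u. coeff p s * t ^ s)"
    by (simp add: sum_distrib_left power_add mult_ac)
  also have "(\<Sum>s\<le>u. coeff p s * t ^ s) = poly p t"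
    unfolding poly_altdef using assms(1) by (intro sum.mono_neutral_right) (auto simp: coeff_eq_0)
  finally show ?thesis .
qed

text \<open>At a point of the curve the matrix has the kernel vector with entries \<open>t ^ l\<close> in the first
  \<open>2 u\<close> columns and \<open>- Q(t) * t ^ m\<close> in the extra columns. It is nonzero since its first entry is 1.\<close>

lemma implicit_det_vanishes:
  assumes deg: "\<And>r. r \<in> {0, 1, 2} \<Longrightarrow> degree (P r) \<le> u" and u: "0 < u" and Q: "poly (P 2) t \<noteq> 0"
  shows "eval2 (implicit_det P u) (poly (P 0) t / poly (P 2) t) (poly (P 1) t / poly (P 2) t) = 0"
proof -
  define q where "q = poly (P 2) t"
  define M where "M = Matrix.mat (3 * u) (3 * u) (\<lambda>(a, b). entry P u a b *
     (poly (P 0) t / q) ^ of_bool (2 * u \<le> b \<and> a mod 3 = 0) * (poly (P 1) t / q) ^ of_bool (2 * u \<le> b \<and> a mod 3 = 1))"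
  define v where "v = Matrix.vec (3 * u) (\<lambda>b. if b < 2 * u then t ^ b else - q * t ^ (b - 2 * u))"
  have "M *\<^sub>v v = 0\<^sub>v (3 * u)"
  proof (rule eq_vecI)
    fix a assume "a < dim_vec (0\<^sub>v (3 * u) :: complex vec)"
    then have a: "a < 3 * u" by simp
    define r m where "r = a mod 3" and "m = a div 3"
    have r: "r \<in> {0, 1, 2}" and m: "m < u" using a by (auto simp: r_def m_def)
    have "vec_index (M *\<^sub>v v) a = (\<Sum>b\<in>{0..<3 * u}. M $$ (a, b) * vec_index v b)"
      using a by (simp add: M_def v_def scalar_prod_def)
    also have "\<dots> = (\<Sum>b\<in>{0..<2 * u}. M $$ (a, b) * vec_index v b) + (\<Sum>b\<in>{2 * u..<3 * u}. M $$ (a, b) * vec_index v b)"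
      by (simp add: sum.atLeastLessThan_concat)
    also have "(\<Sum>b\<in>{0..<2 * u}. M $$ (a, b) * vec_index v b)
        = (\<Sum>b<2 * u. (if m \<le> b then coeff (P r) (b - m) else 0) * t ^ b)"
      using a by (intro sum.cong) (auto simp: M_def v_def entry_def r_def m_def)
    also have "\<dots> = t ^ m * poly (P r) t"
      using deg[OF r] m by (rule sum_shifted_coeffs)
    also have "(\<Sum>b\<in>{2 * u..<3 * u}. M $$ (a, b) * vec_index v b)
        = (\<Sum>b\<in>{2 * u..<3 * u}. if b = 2 * u + m then - (poly (P r) t * t ^ m) else 0)"
      using a r Q by (intro sum.cong) (auto simp: M_def v_def entry_def r_def m_def q_def)
    also have "\<dots> = - (poly (P r) t * t ^ m)"
      using m by simp
    finally show "vec_index (M *\<^sub>v v) a = vec_index (0\<^sub>v (3 * u)) a" using a by simp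
  qed (simp add: M_def)
  moreover have "v \<in> carrier_vec (3 * u)" by (simp add: v_def)
  moreover have "v \<noteq> 0\<^sub>v (3 * u)"
  proof
    assume "v = 0\<^sub>v (3 * u)"
    then have "vec_index v 0 = 0" using u by simp
    then show False using u by (simp add: v_def)
  qed
  moreover have "M \<in> carrier_mat (3 * u) (3 * u)" by (simp add: M_def)
  ultimately have "Determinant.det M = 0"
    using det_0_iff_vec_prod_zero by blast
  then show ?thesis
    unfolding eval2_implicit_det M_def q_def .
qed

lemma bij_row_index: "bij_betw (\<lambda>(r, m). 3 * m + r) ({0, 1, 2} \<times> {..<u}) {0..<3 * u::nat}"
  by (rule bij_betw_byWitness[of _ "\<lambda>a. (a mod 3, a div 3)"]) auto

lemma placement_of_perm:
  assumes deg: "\<And>r. r \<in> {0, 1, 2} \<Longrightarrow> degree (P r) \<le> u"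
    and \<sigma>: "\<sigma> permutes {0..<3 * u}" and nz: "\<And>a. a < 3 * u \<Longrightarrow> entry P u a (\<sigma> a) \<noteq> 0"
  defines "F \<equiv> \<lambda>r m. \<sigma> (3 * m + r)"
  shows "placement u (\<lambda>r. {s. coeff (P r) s \<noteq> 0}) F"
    and "r \<in> {0, 1, 2} \<Longrightarrow> num_ext u F r = perm_ext u \<sigma> r"
proof -
  have idx: "3 * m + r < 3 * u" "(3 * m + r) mod 3 = r" "(3 * m + r) div 3 = m"
    if "r \<in> {0, 1, 2}" "m < u" for r m
    using that by auto
  have bij: "bij_betw (\<lambda>(r, m). F r m) ({0, 1, 2} \<times> {..<u}) {..<3 * u}"
  proof -
    have "bij_betw (\<sigma> \<circ> (\<lambda>(r, m). 3 * m + r)) ({0, 1, 2} \<times> {..<u}) {0..<3 * u}"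
      using bij_betw_trans[OF bij_row_index permutes_imp_bij[OF \<sigma>]] .
    then show ?thesis by (simp add: F_def comp_def split_def lessThan_atLeast0)
  qed
  have opt: "F r m = 2 * u + m \<or> (\<exists>s\<in>{s. coeff (P r) s \<noteq> 0}. s \<le> u \<and> F r m = m + s)"
    if r: "r \<in> {0, 1, 2}" "m < u" for r m
  proof (cases "F r m < 2 * u")
    case True
    then have "m \<le> F r m" "coeff (P r) (F r m - m) \<noteq> 0"
      using nz[of "3 * m + r"] idx[OF r] unfolding F_def entry_def by (auto split: if_splits)
    moreover from this(2) have "F r m - m \<le> u"
      using deg[OF r(1)] le_degree by (meson le_trans)
    ultimately show ?thesis by (intro disjI2 bexI[of _ "F r m - m"]) auto
  next
    case False
    then show ?thesis
      using nz[of "3 * m + r"] idx[OF r] unfolding F_def entry_def by (auto split: if_splits)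
  qed
  show "placement u (\<lambda>r. {s. coeff (P r) s \<noteq> 0}) F"
    unfolding placement_def using bij opt by blast
  show "num_ext u F r = perm_ext u \<sigma> r" if r: "r \<in> {0, 1, 2}"
    unfolding num_ext_def perm_ext_def
  proof (rule bij_betw_same_card[of "\<lambda>m. 3 * m + r"], rule bij_betw_byWitness[of _ "\<lambda>a. a div 3"])
    show "(\<lambda>m. 3 * m + r) ` {m. m < u \<and> F r m = 2 * u + m} \<subseteq> {a. a < 3 * u \<and> 2 * u \<le> \<sigma> a \<and> a mod 3 = r}"
      using idx[OF r] by (auto simp: F_def)
    show "(\<lambda>a. a div 3) ` {a. a < 3 * u \<and> 2 * u \<le> \<sigma> a \<and> a mod 3 = r} \<subseteq> {m. m < u \<and> F r m = 2 * u + m}"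
    proof safe
      fix a assume a: "a < 3 * u" "2 * u \<le> \<sigma> a" "r = a mod 3"
      then show "a div 3 < u" by auto
      have "3 * (a div 3) + a mod 3 = a" by simp
      then show "F (a mod 3) (a div 3) = 2 * u + a div 3"
        using nz[OF a(1)] a(2) unfolding F_def entry_def by (auto split: if_splits)
    qed
    show "\<forall>m\<in>{m. m < u \<and> F r m = 2 * u + m}. (3 * m + r) div 3 = m"
      using idx(3)[OF r] by blast
    show "\<forall>a\<in>{a. a < 3 * u \<and> 2 * u \<le> \<sigma> a \<and> a mod 3 = r}. 3 * (a div 3) + r = a"
      using mult_div_mod_eq[of 3] by blast
  qed
qed

lemma perm_of_placement:
  assumes F: "placement u S F" and S: "\<And>r. r \<in> {0, 1, 2} \<Longrightarrow> S r \<subseteq> {s. coeff (P r) s \<noteq> 0}"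
  defines "\<sigma> \<equiv> \<lambda>a. if a < 3 * u then F (a mod 3) (a div 3) else a"
  shows "\<sigma> permutes {0..<3 * u}" and "\<And>a. a < 3 * u \<Longrightarrow> entry P u a (\<sigma> a) \<noteq> 0"
proof -
  have F_bij: "bij_betw (\<lambda>(r, m). F r m) ({0, 1, 2} \<times> {..<u}) {..<3 * u}"
    and F_opt: "\<forall>r\<in>{0, 1, 2}. \<forall>m<u. F r m = 2 * u + m \<or> (\<exists>s\<in>S r. s \<le> u \<and> F r m = m + s)"
    using F unfolding placement_def by (rule conjunct1, rule conjunct2)
  have "bij_betw (\<lambda>a. (a mod 3, a div 3)) {0..<3 * u} ({0, 1, 2} \<times> {..<u::nat})"
    by (rule bij_betw_byWitness[of _ "\<lambda>(r, m). 3 * m + r"]) auto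
  then have "bij_betw ((\<lambda>(r, m). F r m) \<circ> (\<lambda>a. (a mod 3, a div 3))) {0..<3 * u} {..<3 * u}"
    using F_bij by (rule bij_betw_trans)
  then have "bij_betw \<sigma> {0..<3 * u} {0..<3 * u}"
    by (subst bij_betw_cong[where g = "(\<lambda>(r, m). F r m) \<circ> (\<lambda>a. (a mod 3, a div 3))"])
      (auto simp: \<sigma>_def lessThan_atLeast0)
  then show "\<sigma> permutes {0..<3 * u}"
    by (intro bij_imp_permutes) (auto simp: \<sigma>_def)
  fix a assume a: "a < 3 * u"
  have r: "a mod 3 \<in> {0, 1, 2}" and m: "a div 3 < u" using a by auto
  then consider "F (a mod 3) (a div 3) = 2 * u + a div 3"
    | s where "s \<in> S (a mod 3)" "s \<le> u" "F (a mod 3) (a div 3) = a div 3 + s"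
    using F_opt[rule_format, OF r m] by auto
  then show "entry P u a (\<sigma> a) \<noteq> 0"
  proof cases
    case 1
    then show ?thesis using a by (simp add: \<sigma>_def entry_def)
  next
    case 2
    then show ?thesis using a m S[OF r] by (auto simp: \<sigma>_def entry_def)
  qed
qed

lemma coeff_implicit_det_nonzeroD:
  assumes deg: "\<And>r. r \<in> {0, 1, 2} \<Longrightarrow> degree (P r) \<le> u"
    and nz: "coeff (coeff (implicit_det P u) n) m \<noteq> 0"
  obtains F where "placement u (\<lambda>r. {s. coeff (P r) s \<noteq> 0}) F" "num_ext u F 0 = m" "num_ext u F 1 = n"
proof -
  from nz obtain \<sigma> where \<sigma>: "\<sigma> permutes {0..<3 * u}" "perm_ext u \<sigma> 0 = m" "perm_ext u \<sigma> 1 = n"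
      "(\<Prod>a=0..<3 * u. entry P u a (\<sigma> a)) \<noteq> 0"
    unfolding coeff_implicit_det by (elim sum.not_neutral_contains_not_neutral) (auto split: if_splits)
  then have "entry P u a (\<sigma> a) \<noteq> 0" if "a < 3 * u" for a
    using that by auto
  from placement_of_perm[OF deg \<sigma>(1) this] \<sigma>(2,3) show ?thesis
    by (intro that) auto
qed

text \<open>If only one placement has the exponents \<open>(m, n)\<close>, then the coefficient is, up to sign, a product
  of nonzero coefficients of the \<open>P\<^sub>r\<close>.\<close>

lemma coeff_implicit_det_unique_placement:
  assumes deg: "\<And>r. r \<in> {0, 1, 2} \<Longrightarrow> degree (P r) \<le> u"
    and F: "placement u (\<lambda>r. {s. coeff (P r) s \<noteq> 0}) F" "num_ext u F 0 = m" "num_ext u F 1 = n"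
    and uniq: "\<And>G r l. placement u (\<lambda>r. {s. coeff (P r) s \<noteq> 0}) G \<Longrightarrow> num_ext u G 0 = m \<Longrightarrow> num_ext u G 1 = n
      \<Longrightarrow> r \<in> {0, 1, 2} \<Longrightarrow> l < u \<Longrightarrow> G r l = F r l"
  shows "coeff (coeff (implicit_det P u) n) m \<noteq> 0"
proof -
  define \<sigma> where "\<sigma> = (\<lambda>a. if a < 3 * u then F (a mod 3) (a div 3) else a)"
  have \<sigma>: "\<sigma> permutes {0..<3 * u}" "\<And>a. a < 3 * u \<Longrightarrow> entry P u a (\<sigma> a) \<noteq> 0"
    using perm_of_placement[OF F(1), of P] unfolding \<sigma>_def by auto
  have idx: "\<sigma> (3 * l + r) = F r l" if "r \<in> {0, 1, 2}" "l < u" for r l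
    using that by (auto simp: \<sigma>_def)
  have "num_ext u (\<lambda>r l. \<sigma> (3 * l + r)) r = num_ext u F r" if "r \<in> {0, 1, 2}" for r
  proof -
    have "{l. l < u \<and> \<sigma> (3 * l + r) = 2 * u + l} = {l. l < u \<and> F r l = 2 * u + l}"
      using idx[OF that] by auto
    then show ?thesis unfolding num_ext_def by simp
  qed
  then have "perm_ext u \<sigma> r = num_ext u F r" if "r \<in> {0, 1, 2}" for r
    using placement_of_perm(2)[OF deg \<sigma> that] that by simp
  then have ext: "perm_ext u \<sigma> 0 = m" "perm_ext u \<sigma> 1 = n"
    using F(2,3) by simp_all
  have eq_\<sigma>: "\<tau> = \<sigma>"
    if \<tau>: "\<tau> permutes {0..<3 * u}" "perm_ext u \<tau> 0 = m" "perm_ext u \<tau> 1 = n"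
      "(\<Prod>a=0..<3 * u. entry P u a (\<tau> a)) \<noteq> 0" for \<tau>
  proof
    fix a
    have nz: "entry P u a (\<tau> a) \<noteq> 0" if "a < 3 * u" for a
      using \<tau>(4) that by auto
    show "\<tau> a = \<sigma> a"
    proof (cases "a < 3 * u")
      case True
      then have a: "a mod 3 \<in> {0, 1, 2}" "a div 3 < u" by auto
      have ext_\<tau>: "num_ext u (\<lambda>r l. \<tau> (3 * l + r)) 0 = m" "num_ext u (\<lambda>r l. \<tau> (3 * l + r)) 1 = n"
        using placement_of_perm(2)[OF deg \<tau>(1) nz, of 0] placement_of_perm(2)[OF deg \<tau>(1) nz, of 1] \<tau>(2,3)
        by simp_all
      have "\<tau> (3 * (a div 3) + a mod 3) = F (a mod 3) (a div 3)"
        using uniq[OF placement_of_perm(1)[OF deg \<tau>(1) nz] ext_\<tau> a] .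
      then show ?thesis using True by (simp add: \<sigma>_def)
    next
      case False
      then show ?thesis using \<tau>(1) \<sigma>(1) by (simp add: permutes_not_in)
    qed
  qed
  have "coeff (coeff (implicit_det P u) n) m =
      (\<Sum>\<tau> | \<tau> permutes {0..<3 * u}. if \<tau> = \<sigma> then signof \<sigma> * (\<Prod>a=0..<3 * u. entry P u a (\<sigma> a)) else 0)"
    unfolding coeff_implicit_det
  proof (rule sum.cong[OF refl])
    fix \<tau> assume \<tau>: "\<tau> \<in> {\<tau>. \<tau> permutes {0..<3 * u}}"
    show "(if perm_ext u \<tau> 0 = m \<and> perm_ext u \<tau> 1 = n
        then signof \<tau> * (\<Prod>a=0..<3 * u. entry P u a (\<tau> a)) else 0)
      = (if \<tau> = \<sigma> then signof \<sigma> * (\<Prod>a=0..<3 * u. entry P u a (\<sigma> a)) else 0)"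
    proof (cases "\<tau> = \<sigma>")
      case True
      then show ?thesis using ext by simp
    next
      case False
      then have "\<not> (perm_ext u \<tau> 0 = m \<and> perm_ext u \<tau> 1 = n) \<or> (\<Prod>a=0..<3 * u. entry P u a (\<tau> a)) = 0"
        using eq_\<sigma>[of \<tau>] \<tau> by blast
      then show ?thesis using False by (metis mult_zero_right)
    qed
  qed
  also have "\<dots> = signof \<sigma> * (\<Prod>a=0..<3 * u. entry P u a (\<sigma> a))"
    using \<sigma>(1) by (simp add: finite_permutations)
  finally show ?thesis using \<sigma>(2) by (auto simp: sign_def)
qed

lemma coeff_implicit_det_polynomial_map:
  assumes "\<And>r s. r \<in> {0, 1, 2} \<Longrightarrow> (\<lambda>c. coeff (P c r) s) \<in> polynomial_maps S"
  shows "(\<lambda>c. coeff (coeff (implicit_det (P c) u) n) m) \<in> polynomial_maps S"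
proof -
  have entry: "(\<lambda>c. entry (P c) u a b) \<in> polynomial_maps S" for a b
  proof -
    have "(\<lambda>c. coeff (P c (a mod 3)) (b - a div 3)) \<in> polynomial_maps S"
      using less_Suc_eq by (intro assms) auto
    then show ?thesis
      unfolding entry_def
      using polynomial_maps.const[of 0 S] polynomial_maps.const[of 1 S]
      by (cases "b < 2 * u"; cases "a div 3 \<le> b"; cases "b = 2 * u + a div 3") simp_all
  qed
  have leibniz: "(\<lambda>c. signof \<sigma> * (\<Prod>a=0..<3 * u. entry (P c) u a (\<sigma> a))) \<in> polynomial_maps S" for \<sigma>
    using polynomial_maps.mult[OF polynomial_maps.const[of "signof \<sigma>" S]
        polynomial_maps_prod[of "{0..<3 * u}" "\<lambda>a c. entry (P c) u a (\<sigma> a)" S, OF entry]] .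
  show ?thesis
    unfolding coeff_implicit_det
  proof (rule polynomial_maps_sum)
    fix \<sigma>
    show "(\<lambda>c. if perm_ext u \<sigma> 0 = m \<and> perm_ext u \<sigma> 1 = n
        then signof \<sigma> * (\<Prod>a=0..<3 * u. entry (P c) u a (\<sigma> a)) else 0) \<in> polynomial_maps S"
      using leibniz[of \<sigma>] polynomial_maps.const[of 0 S]
      by (cases "perm_ext u \<sigma> 0 = m \<and> perm_ext u \<sigma> 1 = n") (simp_all only: if_True if_False simp_thms)
  qed
qed

section \<open>The implicit equation is the determinant up to a constant\<close>

lemma eval2_altdef:
  "eval2 f x y = (\<Sum>n\<le>degree f. \<Sum>m\<le>degree (coeff f n). coeff (coeff f n) m * x ^ m * y ^ n)"
  unfolding eval2_def poly_altdef[of f] poly_sum poly_mult poly_power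
  by (simp add: poly_altdef sum_distrib_right)

text \<open>Identities between bivariate polynomials, such as multiplicativity of the exchange of the two
  variables, are then checked on values.\<close>

lemma eval2_inject:
  assumes "\<And>x y. eval2 f x y = eval2 g x y"
  shows "f = g"
proof (rule ccontr)
  assume "f \<noteq> g"
  then have fin: "finite {a. poly (f - g) a = 0}" by (intro poly_roots_finite) simp
  have "poly (f - g) [:y:] = 0" for y
  proof -
    have "\<forall>x. poly (poly (f - g) [:y:]) x = 0"
      using assms by (simp add: eval2_def)
    then show ?thesis using poly_all_0_iff_0 by blast
  qed
  then have "range (\<lambda>y::complex. [:y:]) \<subseteq> {a. poly (f - g) a = 0}" by auto
  with fin have "finite (range (\<lambda>y::complex. [:y:]))" by (rule rev_finite_subset)
  then have "finite (UNIV :: complex set)"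
    by (rule finite_imageD) (simp add: inj_on_def)
  then show False using infinite_UNIV_char_0 by blast
qed

lemma eval2_mult: "eval2 (f * g) x y = eval2 f x y * eval2 g x y"
  by (simp add: eval2_def)

definition swap_vars :: "complex poly poly \<Rightarrow> complex poly poly" where
  "swap_vars f = (\<Sum>n\<le>degree f. \<Sum>m\<le>degree (coeff f n). mono2 (coeff (coeff f n) m) n m)"

lemma eval2_swap_vars: "eval2 (swap_vars f) x y = eval2 f y x"
proof -
  interpret comm_ring_hom "\<lambda>f. eval2 f x y" by (rule eval2_hom)
  show ?thesis
    unfolding swap_vars_def eval2_altdef[of f] by (simp add: hom_sum eval2_mono2 mult_ac)
qed

lemma coeff_swap_vars: "coeff (coeff (swap_vars f) m) n = coeff (coeff f n) m"
proof -
  have "coeff (coeff (swap_vars f) m) n =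
      (\<Sum>n'\<le>degree f. if n' = n then (\<Sum>m'\<le>degree (coeff f n'). if m' = m then coeff (coeff f n') m' else 0) else 0)"
    unfolding swap_vars_def coeff_sum coeff_mono2 by (intro sum.cong refl) auto
  also have "\<dots> = coeff (coeff f n) m"
    by (auto simp: not_le coeff_eq_0)
  finally show ?thesis .
qed

lemma swap_vars_mult: "swap_vars (f * g) = swap_vars f * swap_vars g"
  by (rule eval2_inject) (simp add: eval2_swap_vars eval2_mult)

lemma swap_vars_eq_0_iff [simp]: "swap_vars f = 0 \<longleftrightarrow> f = 0"
proof
  assume "swap_vars f = 0"
  then have "eval2 f x y = eval2 0 x y" for x y
    using eval2_swap_vars[of f y x] by (simp add: eval2_def)
  then show "f = 0" by (rule eval2_inject)
qed (simp add: swap_vars_def mono2_def)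

lemma vanishing_ideal_swap: "f \<in> vanishing_ideal P0 P1 Q \<Longrightarrow> swap_vars f \<in> vanishing_ideal P1 P0 Q"
  by (simp add: vanishing_ideal_def eval2_swap_vars)

lemma has_param_degree_swap:
  assumes "has_param_degree P0 P1 Q d"
  shows "has_param_degree P1 P0 Q d"
proof -
  have "{s. poly Q s \<noteq> 0 \<and> poly P1 s / poly Q s = poly P1 t / poly Q t \<and> poly P0 s / poly Q s = poly P0 t / poly Q t}
    = {s. poly Q s \<noteq> 0 \<and> poly P0 s / poly Q s = poly P0 t / poly Q t \<and> poly P1 s / poly Q s = poly P1 t / poly Q t}" (is "?R t = ?L t") for t
    by (rule Collect_cong) (rule conj_cong[OF refl conj_commute])
  then have "card (?R t) = card (?L t)" for t by (rule arg_cong)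
  with assms show ?thesis
    unfolding has_param_degree_def by (simp only:)
qed

lemma card_roots_rsquarefree:
  fixes p :: "complex poly"
  assumes "rsquarefree p"
  shows "card {z. poly p z = 0} = degree p"
proof -
  have p: "p \<noteq> 0" using assms by (simp add: rsquarefree_def)
  have "degree p = degree (Polynomial.smult (lead_coeff p) (\<Prod>z|poly p z = 0. [:-z, 1:]))"
    using complex_poly_decompose_rsquarefree[OF assms] by simp
  also have "\<dots> = (\<Sum>z|poly p z = 0. degree [:-z, 1:])"
    using p by (simp add: degree_prod_eq_sum_degree)
  finally show ?thesis by simp
qed

text \<open>The derivative of \<open>P / Q\<close> is not identically zero; its zeros are the parameters at which a line
  \<open>x = const\<close> can be tangent to the curve.\<close>

lemma wronskian_nonzero:
  fixes P Q :: "complex poly"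
  assumes "coprime P Q" "Q \<noteq> 0" "degree P \<noteq> 0 \<or> degree Q \<noteq> 0"
  shows "pderiv P * Q - P * pderiv Q \<noteq> 0"
proof
  assume "pderiv P * Q - P * pderiv Q = 0"
  then have eq: "pderiv P * Q = P * pderiv Q" by simp
  then have "Q dvd P * pderiv Q" by (metis dvd_triv_right)
  then have "Q dvd pderiv Q"
    using coprime_dvd_mult_right_iff[of Q P "pderiv Q"] assms(1) by (simp only: coprime_commute)
  have "pderiv Q = 0"
  proof (rule ccontr)
    assume nz: "pderiv Q \<noteq> 0"
    then have "degree Q \<le> degree (pderiv Q)" using \<open>Q dvd pderiv Q\<close> by (rule dvd_imp_degree_le[rotated])
    moreover have "degree Q \<noteq> 0" using nz by (simp add: pderiv_eq_0_iff)
    ultimately show False by (simp add: degree_pderiv)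
  qed
  then have "pderiv P = 0" using eq assms(2) by simp
  with \<open>pderiv Q = 0\<close> assms(3) show False by (simp add: pderiv_eq_0_iff)
qed

lemma poly_map_poly_eval: "poly (map_poly (\<lambda>p. poly p x) f) y = eval2 f x y"
  unfolding eval2_def by (induction f) (simp_all add: map_poly_pCons)

text \<open>For all but finitely many \<open>x\<close> the polynomial \<open>P0 - x * Q\<close> has degree \<open>u\<close> and only simple roots, so
  there are \<open>u\<close> parameters over \<open>x\<close>. Since the parameterization is generically injective they give
  \<open>u\<close> different values of \<open>y\<close>, all of them roots of \<open>\<phi>(x, y)\<close> as a polynomial in \<open>y\<close>.\<close>

lemma vanishing_degree_ge:
  assumes van: "\<phi> \<in> vanishing_ideal P0 P1 Q" and nz: "\<phi> \<noteq> 0"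
    and cop: "coprime P0 Q" and par: "has_param_degree P0 P1 Q 1"
    and deg: "degree P0 \<le> u" "degree Q \<le> u" and lead: "coeff P0 u \<noteq> 0 \<or> coeff Q u \<noteq> 0"
  shows "u \<le> degree \<phi>"
proof (cases "u = 0")
  case False
  define fib where "fib t = {s. poly Q s \<noteq> 0 \<and> poly P0 s / poly Q s = poly P0 t / poly Q t
      \<and> poly P1 s / poly Q s = poly P1 t / poly Q t}" for t
  define Z where "Z = {t. \<not> (poly Q t \<noteq> 0 \<and> card (fib t) = 1)}"
  have "finite Z"
    using par unfolding has_param_degree_def eventually_cofinite Z_def fib_def by simp
  have "Q \<noteq> 0"
  proof
    assume "Q = 0"
    then have "Z = UNIV" by (simp add: Z_def)
    then show False using \<open>finite Z\<close> infinite_UNIV_char_0 by metis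
  qed
  define W where "W = pderiv P0 * Q - P0 * pderiv Q"
  have "degree P0 \<noteq> 0 \<or> degree Q \<noteq> 0"
    using lead False by (metis coeff_eq_0 not_gr0)
  then have "W \<noteq> 0"
    unfolding W_def using cop \<open>Q \<noteq> 0\<close> by (intro wronskian_nonzero)
  \<comment> \<open>the values of \<open>x\<close> over parameters with a bad fibre or a vertical tangent, and those at which \<open>P0 - x * Q\<close> or \<open>\<phi>(x, y)\<close> drops in degree\<close>
  define bad where "bad = (\<lambda>t. poly P0 t / poly Q t) ` (Z \<union> {t. poly W t = 0})
      \<union> {x. poly [:coeff P0 u, - coeff Q u:] x = 0} \<union> {x. poly (lead_coeff \<phi>) x = 0}"
  have "finite bad"
    unfolding bad_def using \<open>finite Z\<close> \<open>W \<noteq> 0\<close> nz lead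
    by (intro finite_UnI finite_imageI poly_roots_finite) auto
  then obtain x where x: "x \<notin> bad"
    using infinite_UNIV_char_0 ex_new_if_finite by metis
  define p where "p = P0 - Polynomial.smult x Q"
  have "coeff p u \<noteq> 0" using x by (auto simp: p_def bad_def)
  moreover have "degree p \<le> u" unfolding p_def using deg by (intro degree_diff_le) (auto intro: order_trans[OF degree_smult_le])
  ultimately have "degree p = u" by (simp add: le_antisym le_degree)
  have root: "poly Q t \<noteq> 0" "poly P0 t / poly Q t = x" "t \<notin> Z" "poly W t \<noteq> 0" if "poly p t = 0" for t
  proof -
    have eq: "poly P0 t = x * poly Q t" using that by (simp add: p_def)
    then show q: "poly Q t \<noteq> 0" using coprime_poly_0[OF cop, of t] by auto
    with eq show xt: "poly P0 t / poly Q t = x" by simp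
    with x show "t \<notin> Z" "poly W t \<noteq> 0" unfolding bad_def by blast+
  qed
  have "rsquarefree p"
    unfolding rsquarefree_roots
  proof safe
    fix t assume t: "poly p t = 0" "poly (pderiv p) t = 0"
    then have "poly W t = 0"
      by (simp add: W_def p_def pderiv_diff pderiv_smult algebra_simps)
    then show False using root(4)[OF t(1)] by simp
  qed
  then have card: "card {t. poly p t = 0} = u"
    using card_roots_rsquarefree \<open>degree p = u\<close> by simp
  define g where "g = map_poly (\<lambda>a. poly a x) \<phi>"
  have "coeff g (degree \<phi>) = poly (lead_coeff \<phi>) x" by (simp add: g_def coeff_map_poly)
  then have "g \<noteq> 0" using x by (auto simp: bad_def)
  have inj: "inj_on (\<lambda>t. poly P1 t / poly Q t) {t. poly p t = 0}"
  proof (rule inj_onI, clarify)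
    fix s t assume s: "poly p s = 0" and t: "poly p t = 0" and eq: "poly P1 s / poly Q s = poly P1 t / poly Q t"
    have "s \<in> fib t" "t \<in> fib t" using root[OF s] root[OF t] eq by (auto simp: fib_def)
    moreover have "card (fib t) = 1" using root(3)[OF t] by (simp add: Z_def)
    ultimately show "s = t" by (metis card_1_singletonE singletonD)
  qed
  have "u = card ((\<lambda>t. poly P1 t / poly Q t) ` {t. poly p t = 0})"
    using card card_image[OF inj] by simp
  also have "\<dots> \<le> card {y. poly g y = 0}"
  proof (rule card_mono)
    show "finite {y. poly g y = 0}" using \<open>g \<noteq> 0\<close> by (rule poly_roots_finite)
    show "(\<lambda>t. poly P1 t / poly Q t) ` {t. poly p t = 0} \<subseteq> {y. poly g y = 0}"
    proof clarify
      fix t assume t: "poly p t = 0"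
      have "eval2 \<phi> (poly P0 t / poly Q t) (poly P1 t / poly Q t) = 0"
        using van root(1)[OF t] by (simp add: vanishing_ideal_def)
      then show "poly g (poly P1 t / poly Q t) = 0"
        unfolding root(2)[OF t] g_def poly_map_poly_eval .
    qed
  qed
  also have "\<dots> \<le> degree g" using \<open>g \<noteq> 0\<close> by (rule card_poly_roots_bound)
  also have "\<dots> \<le> degree \<phi>" unfolding g_def by (intro degree_le) (simp add: coeff_map_poly coeff_eq_0)
  finally show ?thesis .
qed simp

text \<open>The cofactor has degree 0 in \<open>y\<close>, and it divides the coefficient of \<open>y ^ u\<close> in \<open>D\<close>, which is
  constant because of the bound on the total degree.\<close>

lemma cofactor_constant:
  fixes D \<phi> \<psi> :: "complex poly poly"
  assumes D: "D = \<phi> * \<psi>" "D \<noteq> 0" and deg: "u \<le> degree \<phi>"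
    and supp: "\<And>m n. coeff (coeff D n) m \<noteq> 0 \<Longrightarrow> m + n \<le> u"
  shows "\<exists>a. a \<noteq> 0 \<and> D = Polynomial.smult [:a:] \<phi>"
proof -
  have nz: "\<phi> \<noteq> 0" "\<psi> \<noteq> 0" using D by auto
  have "degree D \<le> u"
  proof (rule degree_le, safe)
    fix n assume "u < n"
    then show "coeff D n = 0" using supp by (intro poly_eqI) (force simp: coeff_0)
  qed
  moreover have "degree D = degree \<phi> + degree \<psi>" unfolding D(1) using nz by (rule degree_mult_eq)
  ultimately have "degree \<psi> = 0" "degree D = u" using deg by auto
  then obtain p where p: "\<psi> = [:p:]" by (metis degree_eq_zeroE)
  then have D_eq: "D = Polynomial.smult p \<phi>" using D(1) by simp
  have lead: "coeff D u \<noteq> 0" using D(2) \<open>degree D = u\<close> by auto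
  have "degree (coeff D u) = 0"
    using supp[of u "degree (coeff D u)"] lead by auto
  moreover have "coeff D u = p * coeff \<phi> u" using D_eq by simp
  ultimately have "degree p = 0" using lead by (simp add: degree_mult_eq)
  then obtain a where "p = [:a:]" by (metis degree_eq_zeroE)
  with D_eq D(2) show ?thesis by auto
qed

text \<open>The maximal degree \<open>u\<close> is attained by \<open>P\<^sub>0\<close>, \<open>P\<^sub>1\<close> or \<open>Q\<close>. If it is \<open>P\<^sub>0\<close> or \<open>Q\<close>, the lines
  \<open>x = const\<close> meet the curve in \<open>u\<close> points; if it is \<open>P\<^sub>1\<close>, exchanging \<open>x\<close> and \<open>y\<close> reduces to
  that situation.\<close>

lemma implicit_equation_proportional:
  assumes impl: "implicitization B c \<phi>"
    and deg: "\<And>r. r \<in> {0, 1, 2} \<Longrightarrow> degree (supp_poly B c r) \<le> u" and u: "0 < u"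
    and D: "implicit_det (supp_poly B c) u \<noteq> 0"
    and l: "l \<in> {0, 1, 2}" "coeff (supp_poly B c l) u \<noteq> 0"
  shows "\<exists>a. a \<noteq> 0 \<and> implicit_det (supp_poly B c) u = Polynomial.smult [:a:] \<phi>"
proof -
  define P where "P = supp_poly B c"
  let ?D = "implicit_det P u"
  have impl': "coprime (P 0) (P 2)" "coprime (P 1) (P 2)" "has_param_degree (P 0) (P 1) (P 2) 1"
      "vanishing_ideal (P 0) (P 1) (P 2) = {f. \<phi> dvd f}"
    using impl by (auto simp: implicitization_def is_implicit_equation_def P_def Let_def)
  have "?D \<in> vanishing_ideal (P 0) (P 1) (P 2)"
    using implicit_det_vanishes[of P u] deg u by (auto simp: vanishing_ideal_def P_def)
  then obtain \<psi> where \<psi>: "?D = \<phi> * \<psi>" using impl'(4) by (auto elim: dvdE)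
  have van: "\<phi> \<in> vanishing_ideal (P 0) (P 1) (P 2)" using impl'(4) by simp
  have nz: "\<phi> \<noteq> 0" using D \<psi> by (auto simp: P_def)
  have supp: "m + n \<le> u" if mn: "coeff (coeff ?D n) m \<noteq> 0" for m n
  proof -
    obtain F where F: "placement u (\<lambda>r. {s. coeff (P r) s \<noteq> 0}) F"
        "num_ext u F 0 = m" "num_ext u F 1 = n"
      by (rule coeff_implicit_det_nonzeroD[OF deg[folded P_def] mn])
    then interpret placement_roles u "\<lambda>r. {s. coeff (P r) s \<noteq> 0}" F 0 1 2
      by unfold_locales auto
    show ?thesis using sum_num_ext F by simp
  qed
  show ?thesis
  proof (cases "l = 1")
    case False
    then have "u \<le> degree \<phi>"
      using l deg by (intro vanishing_degree_ge[OF van nz impl'(1,3)]) (auto simp: P_def)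
    from cofactor_constant[OF \<psi> _ this supp] D show ?thesis unfolding P_def by blast
  next
    case True
    have "u \<le> degree (swap_vars \<phi>)"
      using l deg True nz
      by (intro vanishing_degree_ge[OF vanishing_ideal_swap[OF van] _ impl'(2) has_param_degree_swap[OF impl'(3)]])
        (auto simp: P_def)
    moreover have "swap_vars ?D = swap_vars \<phi> * swap_vars \<psi>" "swap_vars ?D \<noteq> 0"
      using \<psi> swap_vars_mult D by (auto simp: P_def)
    moreover have "m + n \<le> u" if "coeff (coeff (swap_vars ?D) n) m \<noteq> 0" for m n
      using supp[of m n] that by (simp add: coeff_swap_vars add.commute)
    ultimately obtain a where a: "a \<noteq> 0" "swap_vars ?D = Polynomial.smult [:a:] (swap_vars \<phi>)"
      using cofactor_constant by metis
    have "coeff (coeff ?D n) m = coeff (coeff (Polynomial.smult [:a:] \<phi>) n) m" for m n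
      using arg_cong[OF a(2), of "\<lambda>f. coeff (coeff f m) n"] by (simp add: coeff_swap_vars)
    then have "?D = Polynomial.smult [:a:] \<phi>" by (intro poly_eqI) blast
    with a(1) show ?thesis unfolding P_def by blast
  qed
qed

section \<open>Newton polygons and support functions\<close>

lemma coeff_supp_poly:
  assumes "finite (B r)"
  shows "coeff (supp_poly B c r) s = (if s \<in> B r then c (r, s) else 0)"
  using assms by (simp add: supp_poly_def coeff_sum coeff_monom)

definition support2 :: "complex poly poly \<Rightarrow> (nat \<times> nat) set" where
  "support2 f = {(m, n). coeff (coeff f n) m \<noteq> 0}"

definition real_point :: "nat \<times> nat \<Rightarrow> real \<times> real" where
  "real_point = (\<lambda>(m, n). (real m, real n))"

lemma newton_polygon_eq: "newton_polygon f = convex hull (real_point ` support2 f)"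
proof -
  have "{(real m, real n) |m n. coeff (coeff f n) m \<noteq> 0} = real_point ` support2 f"
    by (auto simp: real_point_def support2_def image_def)
  then show ?thesis by (simp add: newton_polygon_def)
qed

text \<open>A point outside the hull would be separated from it by a linear functional.\<close>

lemma subset_convex_hullI:
  fixes V :: "(real \<times> real) set"
  assumes "finite V" and "\<And>a x. x \<in> X \<Longrightarrow> \<exists>v\<in>V. inner a v \<le> inner a x"
  shows "X \<subseteq> convex hull V"
proof
  fix x assume x: "x \<in> X"
  show "x \<in> convex hull V"
  proof (rule ccontr)
    assume "x \<notin> convex hull V"
    moreover have "closed (convex hull V)"
      using assms(1) by (simp add: compact_imp_closed compact_convex_hull finite_imp_compact)
    ultimately obtain a b where ab: "inner a x < b" "\<And>y. y \<in> convex hull V \<Longrightarrow> b < inner a y"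
      using separating_hyperplane_closed_point[of "convex hull V" x] convex_convex_hull by blast
    obtain v where "v \<in> V" "inner a v \<le> inner a x" using assms(2)[OF x] by blast
    then show False using ab(1) ab(2)[OF hull_inc[OF \<open>v \<in> V\<close>]] by simp
  qed
qed

text \<open>The largest admissible slope \<open>l = min (x / a) (y / b)\<close> in the case where the minimum is \<open>x / a\<close>,
  without division by zero.\<close>

lemma scaled_bound:
  fixes a b x y :: real
  assumes "0 \<le> a" "0 \<le> b" "0 \<le> x" "0 \<le> y" "x * b \<le> y * a"
  shows "\<exists>l\<ge>0. l * a \<le> x \<and> l * b \<le> y \<and> l * (a * b) = x * b"
proof (cases "a = 0")
  case True
  then have "x * b \<le> 0" "0 \<le> x * b" using assms by simp_all
  then have "x * b = 0" by (rule antisym)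
  with True assms show ?thesis by (intro exI[of _ 0]) auto
next
  case False
  then have "a > 0" using assms by simp
  then show ?thesis using assms by (intro exI[of _ "x / a"]) (auto simp: field_simps)
qed

text \<open>The largest admissible \<open>\<mu>\<close> is \<open>wi / ai\<close> or \<open>wj / aj\<close>, and the largest \<open>\<kappa>\<close> is \<open>wi / zi\<close> or
  \<open>wj / zj\<close>. Three of the four combinations turn the bound into the value of the functional at
  \<open>(aj, zi)\<close>, \<open>(aj + zj, 0)\<close> and \<open>(0, zi + ai)\<close>, and the fourth one contradicts \<open>order\<close>.
  Functionals with a negative weight are minimal on the edge from \<open>(u, 0)\<close> to \<open>(0, u)\<close>.

  The side conditions in the list drop a point where its coefficient may vanish. In that
  situation another point of the list has at most the same value of the functional.\<close>

lemma pentagon_support_function: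
  fixes ei ej ai aj zi zj u wi wj :: real
  assumes nonneg: "0 \<le> ai" "0 \<le> aj" "0 \<le> zi" "0 \<le> zj" "0 \<le> ei" "0 \<le> ej" and le: "ei + ej \<le> u"
    and order: "aj * zi \<le> ai * zj"
    and bound: "\<And>\<mu> \<kappa>. 0 \<le> \<mu> \<Longrightarrow> \<mu> * ai \<le> wi \<Longrightarrow> \<mu> * aj \<le> wj \<Longrightarrow>
      0 \<le> \<kappa> \<Longrightarrow> \<kappa> * zi \<le> wi \<Longrightarrow> \<kappa> * zj \<le> wj \<Longrightarrow>
      \<mu> * (ai * aj) + \<kappa> * (zi * zj) \<le> wi * ei + wj * ej"
  shows "\<exists>(vi, vj) \<in> {(u, 0), (0, u)} \<union> {v. 0 < aj \<and> v = (0, zi + ai)} \<union> {v. 0 < zi \<and> v = (aj + zj, 0)}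
      \<union> {v. aj + zi < u \<and> v = (aj, zi)}. wi * vi + wj * vj \<le> wi * ei + wj * ej"
    (is "\<exists>(vi, vj) \<in> ?C. _")
proof -
  have via: "?thesis" if "(vi, vj) \<in> ?C" "wi * vi + wj * vj \<le> wi * ei + wj * ej" for vi vj
    using that by blast
  \<comment> \<open>the edge from \<open>(u, 0)\<close> to \<open>(0, u)\<close>, whose better endpoint has the value \<open>min wi wj * u\<close>\<close>
  have far: ?thesis if "min wi wj * u \<le> wi * ei + wj * ej"
  proof (cases "wi \<le> wj")
    case True
    then show ?thesis using that by (intro via[of u 0]) auto
  next
    case False
    then show ?thesis using that by (intro via[of 0 u]) auto
  qed
  show ?thesis
  proof (cases "0 \<le> wi \<and> 0 \<le> wj")
    case False
    then have neg: "min wi wj < 0" by auto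
    have "min wi wj * u \<le> min wi wj * (ei + ej)"
      using le neg by (intro mult_left_mono_neg) auto
    also have "\<dots> = min wi wj * ei + min wi wj * ej" by (simp add: algebra_simps)
    also have "\<dots> \<le> wi * ei + wj * ej"
      using nonneg by (intro add_mono mult_right_mono) auto
    finally show ?thesis by (rule far)
  next
    case True
    then have w: "0 \<le> wi" "0 \<le> wj" by auto
    \<comment> \<open>if \<open>(aj, zi)\<close> is not in the list, then it lies on or beyond the edge from \<open>(u, 0)\<close> to \<open>(0, u)\<close>\<close>
    have middle: ?thesis if mid: "wi * aj + wj * zi \<le> wi * ei + wj * ej"
    proof (cases "aj + zi < u")
      case True
      then show ?thesis using mid by (intro via[of aj zi]) auto
    next
      case False
      have "min wi wj * u \<le> min wi wj * (aj + zi)"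
        using False w by (intro mult_left_mono) auto
      also have "\<dots> = min wi wj * aj + min wi wj * zi" by (simp add: algebra_simps)
      also have "\<dots> \<le> wi * aj + wj * zi"
        using nonneg by (intro add_mono mult_right_mono) auto
      finally show ?thesis using mid by (intro far) linarith
    qed
    consider (L1K1) "wi * aj \<le> wj * ai" "wj * zi \<le> wi * zj"
      | (L1K2) "wi * aj \<le> wj * ai" "wi * zj \<le> wj * zi"
      | (L2K1) "wj * ai \<le> wi * aj" "wj * zi \<le> wi * zj"
      | (L2K2) "wj * ai < wi * aj" "wi * zj < wj * zi"
      by linarith
    then show ?thesis
    proof cases
      case L1K1
      obtain \<mu> where l: "0 \<le> \<mu>" "\<mu> * ai \<le> wi" "\<mu> * aj \<le> wj" "\<mu> * (ai * aj) = wi * aj"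
        using scaled_bound[of ai aj wi wj] nonneg w L1K1 by auto
      obtain \<kappa> where "0 \<le> \<kappa>" "\<kappa> * zj \<le> wj" "\<kappa> * zi \<le> wi" "\<kappa> * (zj * zi) = wj * zi"
        using scaled_bound[of zj zi wj wi] nonneg w L1K1 by auto
      with bound[of \<mu> \<kappa>] l show ?thesis by (intro middle) (simp add: mult.commute[of zi zj])
    next
      case L1K2
      obtain \<mu> where l: "0 \<le> \<mu>" "\<mu> * ai \<le> wi" "\<mu> * aj \<le> wj" "\<mu> * (ai * aj) = wi * aj"
        using scaled_bound[of ai aj wi wj] nonneg w L1K2 by auto
      obtain \<kappa> where "0 \<le> \<kappa>" "\<kappa> * zi \<le> wi" "\<kappa> * zj \<le> wj" "\<kappa> * (zi * zj) = wi * zj"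
        using scaled_bound[of zi zj wi wj] nonneg w L1K2 by auto
      with bound[of \<mu> \<kappa>] l have b: "wi * aj + wi * zj \<le> wi * ei + wj * ej" by simp
      show ?thesis
      proof (cases "zi = 0")
        case True
        moreover from True L1K2 have "wi * zj = 0" using mult_nonneg_nonneg[OF w(1) nonneg(4)] by simp
        ultimately show ?thesis using b by (intro middle) auto
      next
        case False
        then show ?thesis using b nonneg by (intro via[of "aj + zj" 0]) (auto simp: algebra_simps)
      qed
    next
      case L2K1
      obtain \<mu> where l: "0 \<le> \<mu>" "\<mu> * aj \<le> wj" "\<mu> * ai \<le> wi" "\<mu> * (aj * ai) = wj * ai"
        using scaled_bound[of aj ai wj wi] nonneg w L2K1 by auto
      obtain \<kappa> where "0 \<le> \<kappa>" "\<kappa> * zj \<le> wj" "\<kappa> * zi \<le> wi" "\<kappa> * (zj * zi) = wj * zi"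
        using scaled_bound[of zj zi wj wi] nonneg w L2K1 by auto
      with bound[of \<mu> \<kappa>] l have b: "wj * ai + wj * zi \<le> wi * ei + wj * ej"
        by (simp add: mult.commute[of zi zj] mult.commute[of ai aj])
      show ?thesis
      proof (cases "aj = 0")
        case True
        moreover from True L2K1 have "wj * ai = 0" using mult_nonneg_nonneg[OF w(2) nonneg(1)] by simp
        ultimately show ?thesis using b by (intro middle) auto
      next
        case False
        then show ?thesis using b nonneg by (intro via[of 0 "zi + ai"]) (auto simp: algebra_simps)
      qed
    next
      case L2K2
      have "(wj * ai) * (wi * zj) < (wi * aj) * (wj * zi)"
      proof (rule mult_strict_mono[OF L2K2])
        have "0 \<le> wj * ai" using w nonneg by simp
        then show "0 < wi * aj" using L2K2(1) by (rule le_less_trans)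
        show "0 \<le> wi * zj" using w nonneg by simp
      qed
      then have "(wi * wj) * (ai * zj) < (wi * wj) * (aj * zi)" by (simp add: mult_ac)
      moreover have "(wi * wj) * (aj * zi) \<le> (wi * wj) * (ai * zj)"
        using order w by (intro mult_left_mono) auto
      ultimately show ?thesis by simp
    qed
  qed
qed

lemma inner_eq_hom_coord:
  assumes "{i, j, k} = {0, 1, 2::nat}"
  defines "\<alpha> \<equiv> \<lambda>a l. if l = 0 then fst a else if l = 1 then snd a else (0::real)"
  shows "inner a x = (\<alpha> a i - \<alpha> a k) * hom_coord u i x + (\<alpha> a j - \<alpha> a k) * hom_coord u j x + \<alpha> a k * real u"
proof -
  have m: "i \<in> {0, 1, 2}" "j \<in> {0, 1, 2}" "k \<in> {0, 1, 2}" using assms(1) by blast+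
  note d = roles_distinct[OF assms(1)]
  show ?thesis
    using m d unfolding \<alpha>_def hom_coord_def inner_prod_def inner_real_def
    by (elim insertE emptyE; simp add: algebra_simps)
qed

lemma hom_coord_inj:
  assumes "{i, j, k} = {0, 1, 2::nat}"
  shows "inj (\<lambda>e. (hom_coord u i e, hom_coord u j e))"
proof -
  have m: "i \<in> {0, 1, 2}" "j \<in> {0, 1, 2}" using assms by blast+
  note d = roles_distinct[OF assms]
  show ?thesis
    using m d unfolding hom_coord_def inj_def
    by (elim insertE emptyE; simp add: prod_eq_iff)
qed

section \<open>The support of the determinant for generic coefficients\<close>

locale param_supports =
  fixes B :: "nat \<Rightarrow> nat set" and u :: nat
  assumes fin: "\<And>r. r \<in> {0, 1, 2} \<Longrightarrow> finite (B r)"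
    and le: "\<And>r b. r \<in> {0, 1, 2} \<Longrightarrow> b \<in> B r \<Longrightarrow> b \<le> u"
    and top: "\<exists>l\<in>{0, 1, 2}. u \<in> B l"
begin

definition Det :: "(nat \<times> nat \<Rightarrow> complex) \<Rightarrow> complex poly poly" where
  "Det c = implicit_det (supp_poly B c) u"

text \<open>The exponents whose coefficient in the determinant is not the zero polynomial in \<open>c\<close>.\<close>

definition generic_support :: "(nat \<times> nat) set" where
  "generic_support = (\<Union>c. support2 (Det c))"

lemma degree_le_u: "r \<in> {0, 1, 2} \<Longrightarrow> degree (supp_poly B c r) \<le> u"
proof (rule degree_le, intro allI impI)
  fix s assume r: "r \<in> {0, 1, 2}" and "u < s"
  then have "s \<notin> B r" using le[OF r, of s] by auto
  then show "coeff (supp_poly B c r) s = 0" using coeff_supp_poly[of B r c s] fin[OF r] by simp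
qed

lemma support_placement:
  assumes "(m, n) \<in> support2 (Det c)"
  shows "\<exists>F. placement u B F \<and> (\<forall>r\<in>{0, 1, 2}. hom_coord u r (real m, real n) = real (num_ext u F r))"
proof -
  have nz: "coeff (coeff (implicit_det (supp_poly B c) u) n) m \<noteq> 0"
    using assms by (simp add: support2_def Det_def)
  obtain F where F: "placement u (\<lambda>r. {s. coeff (supp_poly B c r) s \<noteq> 0}) F"
      "num_ext u F 0 = m" "num_ext u F 1 = n"
    by (rule coeff_implicit_det_nonzeroD[where P = "supp_poly B c", OF degree_le_u nz])
  interpret F: placement_roles u "\<lambda>r. {s. coeff (supp_poly B c r) s \<noteq> 0}" F 0 1 2
    by (rule placement_roles.intro[OF refl F(1)])
  have sub: "{s. coeff (supp_poly B c r) s \<noteq> 0} \<subseteq> B r" if "r \<in> {0, 1, 2}" for r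
  proof
    fix s assume "s \<in> {s. coeff (supp_poly B c r) s \<noteq> 0}"
    then show "s \<in> B r" using coeff_supp_poly[of B r c s] fin[OF that] by (cases "s \<in> B r") simp_all
  qed
  have pl: "placement u B F"
    using F(1) sub by (rule placement_mono)
  have "hom_coord u r (real m, real n) = real (num_ext u F r)" if "r \<in> {0, 1, 2}" for r
  proof -
    have "real u = real m + real n + real (num_ext u F 2)"
      using F.sum_num_ext F(2,3) by linarith
    then show ?thesis using that F(2,3) by (elim insertE emptyE) (simp_all add: hom_coord_def)
  qed
  with pl show ?thesis by blast
qed

lemma support_bounds:
  assumes "(m, n) \<in> support2 (Det c)"
  shows "m + n \<le> u"
proof -
  obtain F where F: "placement u B F"
      "\<forall>r\<in>{0, 1, 2}. hom_coord u r (real m, real n) = real (num_ext u F r)"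
    using support_placement[OF assms] by blast
  from F(2)[rule_format, of 2] have "0 \<le> real u - real m - real n" by (simp add: hom_coord_def)
  then show ?thesis by linarith
qed

text \<open>The witness is the coefficient vector that is 1 on the exponents in \<open>S\<close> and 0 elsewhere. Passing
  to such a degenerate vector is what makes placements unique; with the full supports \<open>B\<close> a
  vertex may have many placements.\<close>

lemma unique_placement_in_support:
  assumes roles: "{i, j, k} = {0, 1, 2}"
    and S: "\<And>r. r \<in> {0, 1, 2} \<Longrightarrow> S r \<subseteq> B r"
    and F: "placement u S F"
    and uniq: "\<And>G r l. placement u S G \<Longrightarrow> num_ext u G i = num_ext u F i \<Longrightarrow> num_ext u G j = num_ext u F j \<Longrightarrow>
      num_ext u G k = num_ext u F k \<Longrightarrow> r \<in> {i, j, k} \<Longrightarrow> l < u \<Longrightarrow> G r l = F r l"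
  shows "\<exists>t\<in>generic_support. hom_coord u i (real_point t) = num_ext u F i \<and> hom_coord u j (real_point t) = num_ext u F j"
proof -
  define c where "c = (\<lambda>(r, s). of_bool (s \<in> S r) :: complex)"
  define P where "P = supp_poly B c"
  have supp: "{s. coeff (P r) s \<noteq> 0} = S r" if "r \<in> {0, 1, 2}" for r
    using fin[OF that] S[OF that] by (auto simp: P_def coeff_supp_poly c_def)
  have pl: "placement u (\<lambda>r. {s. coeff (P r) s \<noteq> 0}) G \<longleftrightarrow> placement u S G" for G
  proof
    show "placement u S G" if "placement u (\<lambda>r. {s. coeff (P r) s \<noteq> 0}) G"
      using that by (rule placement_mono) (simp add: supp)
    show "placement u (\<lambda>r. {s. coeff (P r) s \<noteq> 0}) G" if "placement u S G"
      using that by (rule placement_mono) (simp add: supp)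
  qed
  have num: "num_ext u G 0 + num_ext u G 1 + num_ext u G 2 = u" if "placement u S G" for G
  proof -
    interpret placement_roles u S G 0 1 2 by (rule placement_roles.intro[OF refl that])
    show ?thesis by (rule sum_num_ext)
  qed
  define m n where "m = num_ext u F 0" and "n = num_ext u F 1"
  have "coeff (coeff (implicit_det P u) n) m \<noteq> 0"
  proof (rule coeff_implicit_det_unique_placement)
    show "degree (P r) \<le> u" if "r \<in> {0, 1, 2}" for r
      unfolding P_def using that by (rule degree_le_u)
    show "placement u (\<lambda>r. {s. coeff (P r) s \<noteq> 0}) F" using F pl by blast
    show "num_ext u F 0 = m" "num_ext u F 1 = n" by (simp_all add: m_def n_def)
    fix G and r l :: nat
    assume G: "placement u (\<lambda>r. {s. coeff (P r) s \<noteq> 0}) G" "num_ext u G 0 = m" "num_ext u G 1 = n"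
      and r: "r \<in> {0, 1, 2}" and l: "l < u"
    have G': "placement u S G" using G pl by blast
    have "num_ext u G 2 = num_ext u F 2"
      using num[OF G'] num[OF F] G(2,3) by (simp add: m_def n_def)
    then have "num_ext u G q = num_ext u F q" if "q \<in> {0, 1, 2}" for q
      using G(2,3) that by (auto simp: m_def n_def)
    then show "G r l = F r l"
      using r l roles by (intro uniq[OF G']) auto
  qed
  then have "(m, n) \<in> support2 (Det c)" by (simp add: support2_def Det_def P_def)
  moreover have "hom_coord u r (real_point (m, n)) = num_ext u F r" if "r \<in> {0, 1, 2}" for r
    using that num[OF F] by (auto simp: hom_coord_def real_point_def m_def n_def)
  moreover have "i \<in> {0, 1, 2}" "j \<in> {0, 1, 2}" using roles by blast+
  ultimately show ?thesis unfolding generic_support_def by blast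
qed

lemma edge_vertex_in_support:
  assumes roles: "{i, j, k} = {0, 1, 2}"
    and mem: "bL \<in> B i" "bR \<in> B i" "\<beta> \<in> B j" "0 < bL \<Longrightarrow> 0 \<in> B k" "bR < u \<Longrightarrow> u \<in> B k"
    and b: "bL \<le> bR"
    and sep: "bL < bR \<Longrightarrow> bL = 0 \<or> 0 < \<beta>" "bL < bR \<Longrightarrow> bR = u \<or> \<beta> < u"
  shows "\<exists>t\<in>generic_support. hom_coord u i (real_point t) = 0 \<and> hom_coord u j (real_point t) = real u - real bR + real bL"
proof -
  note d = roles_distinct[OF roles]
  have r: "i \<in> {0, 1, 2}" "j \<in> {0, 1, 2}" "k \<in> {0, 1, 2}" using roles by blast+
  have leu: "bR \<le> u" "\<beta> \<le> u" using le r mem by auto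
  define S where "S = (\<lambda>r. if r = i then {bL, bR} else if r = j then {\<beta>} else {0, u} \<inter> B r)"
  have S: "S i = {bL, bR}" "S j = {\<beta>}" "S k = {0, u} \<inter> B k" using d by (auto simp: S_def)
  obtain F where F: "placement u S F" "num_ext u F i = 0" "num_ext u F j = u - (bR - bL)"
    using edge_placement_exists[OF roles, of bL S bR \<beta> u] mem b leu S by auto
  interpret F: placement_roles u S F i j k by (rule placement_roles.intro[OF roles F(1)])
  have main: "\<exists>t\<in>generic_support. hom_coord u i (real_point t) = num_ext u F i \<and> hom_coord u j (real_point t) = num_ext u F j"
  proof (rule unique_placement_in_support[OF roles _ F(1)])
    show "S r \<subseteq> B r" if "r \<in> {0, 1, 2}" for r
      using mem by (auto simp: S_def)
    fix G and r l :: nat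
    assume G: "placement u S G" "num_ext u G i = num_ext u F i" "num_ext u G j = num_ext u F j"
      and r: "r \<in> {i, j, k}" and l: "l < u"
    interpret G: placement_roles u S G i j k by (rule placement_roles.intro[OF roles G(1)])
    have e: "S i \<subseteq> {bL, bR}" "S j \<subseteq> {\<beta>}" "S k \<subseteq> {0, u}" using S by auto
    have "G i l = F i l" "G j l = F j l" "G k l = F k l"
      using G.edge_placement_unique[OF e b leu sep _ _ l] F.edge_placement_unique[OF e b leu sep F(2,3) l] G(2,3) F(2,3) by auto
    then show "G r l = F r l" using r by auto
  qed
  have "real (num_ext u F i) = 0" "real (num_ext u F j) = real u - real bR + real bL"
    using F(2,3) b leu by auto
  with main show ?thesis by simp
qed

lemma inner_vertex_in_support:
  assumes roles: "{i, j, k} = {0, 1, 2}"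
    and mem: "\<alpha> \<in> B i" "\<beta> \<in> B j" "0 \<in> B k" "u \<in> B k" and b: "\<beta> < \<alpha>"
  shows "\<exists>t\<in>generic_support. hom_coord u i (real_point t) = real \<beta> \<and> hom_coord u j (real_point t) = real u - real \<alpha>"
proof -
  note d = roles_distinct[OF roles]
  have r: "i \<in> {0, 1, 2}" "j \<in> {0, 1, 2}" "k \<in> {0, 1, 2}" using roles by blast+
  have leu: "\<alpha> \<le> u" using le r mem by auto
  define S where "S = (\<lambda>r. if r = i then {\<alpha>} else if r = j then {\<beta>} else {0, u} \<inter> B r)"
  have S: "S i = {\<alpha>}" "S j = {\<beta>}" "S k = {0, u}" using d mem by (auto simp: S_def)
  obtain F where F: "placement u S F" "num_ext u F i = \<beta>" "num_ext u F j = u - \<alpha>" "num_ext u F k = \<alpha> - \<beta>"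
    using inner_placement_exists[OF roles, of \<alpha> S \<beta> u] mem b leu S by auto
  interpret F: placement_roles u S F i j k by (rule placement_roles.intro[OF roles F(1)])
  have main: "\<exists>t\<in>generic_support. hom_coord u i (real_point t) = num_ext u F i \<and> hom_coord u j (real_point t) = num_ext u F j"
  proof (rule unique_placement_in_support[OF roles _ F(1)])
    show "S r \<subseteq> B r" if "r \<in> {0, 1, 2}" for r
      using mem by (auto simp: S_def)
    fix G and r l :: nat
    assume G: "placement u S G" "num_ext u G i = num_ext u F i" "num_ext u G j = num_ext u F j" "num_ext u G k = num_ext u F k"
      and r: "r \<in> {i, j, k}" and l: "l < u"
    interpret G: placement_roles u S G i j k by (rule placement_roles.intro[OF roles G(1)])
    have e: "S i \<subseteq> {\<alpha>}" "S j \<subseteq> {\<beta>}" "S k \<subseteq> {0, u}" using S by auto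
    have "G i l = F i l" "G j l = F j l" "G k l = F k l"
      using G.inner_placement_unique[OF e b leu _ _ _ l] F.inner_placement_unique[OF e b leu F(2,3,4) l] G(2,3,4) F(2,3,4) by auto
    then show "G r l = F r l" using r by auto
  qed
  have "real (num_ext u F i) = real \<beta>" "real (num_ext u F j) = real u - real \<alpha>"
    using F(2,3) leu by auto
  with main show ?thesis by simp
qed

lemma finite_generic_support: "finite generic_support"
proof (rule finite_subset)
  show "generic_support \<subseteq> {..u} \<times> {..u}"
    using support_bounds by (fastforce simp: generic_support_def)
qed simp

text \<open>On the open set where the coefficients at all exponents in \<open>T\<close> and one coefficient of \<open>t ^ u\<close>
  are nonzero, \<open>\<phi>\<close> has the same support as the determinant. The exponents in \<open>T\<close> are the ones that
  will turn out to contain the vertices.\<close>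

theorem generic_newton_polygon:
  assumes u: "0 < u" and T: "T \<subseteq> generic_support" "T \<noteq> {}"
    and Q: "\<And>c \<phi>. newton_polygon \<phi> = convex hull (real_point ` support2 (Det c)) \<Longrightarrow> T \<subseteq> support2 (Det c) \<Longrightarrow> Q \<phi>"
  shows "generically (coeff_index B) (\<lambda>c. \<forall>\<phi>. implicitization B c \<phi> \<longrightarrow> Q \<phi>)"
proof -
  \<comment> \<open>the coefficient of \<open>t ^ u\<close> in this polynomial is one of the finitely many that must not vanish\<close>
  obtain l where l: "l \<in> {0, 1, 2}" "u \<in> B l" using top by blast
  define f where "f = (\<lambda>c. c (l, u) * (\<Prod>t\<in>T. coeff (coeff (Det c) (snd t)) (fst t)))"
  have coord: "(\<lambda>c. c (l, u)) \<in> polynomial_maps (coeff_index B)"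
    using l by (intro polynomial_maps.coord) (auto simp: coeff_index_def)
  have coeffs: "(\<lambda>c. coeff (coeff (Det c) n) m) \<in> polynomial_maps (coeff_index B)" for m n
    unfolding Det_def
  proof (rule coeff_implicit_det_polynomial_map)
    fix r s :: nat assume r: "r \<in> {0, 1, 2}"
    show "(\<lambda>c. coeff (supp_poly B c r) s) \<in> polynomial_maps (coeff_index B)"
    proof (cases "s \<in> B r")
      case True
      with r have "(r, s) \<in> coeff_index B" by (simp add: coeff_index_def)
      then show ?thesis using True fin[OF r] by (simp add: coeff_supp_poly polynomial_maps.coord)
    next
      case False
      then show ?thesis using fin[OF r] by (simp add: coeff_supp_poly polynomial_maps.const)
    qed
  qed
  have finT: "finite T" using T(1) finite_generic_support by (rule finite_subset)
  have prod: "(\<lambda>c. \<Prod>t\<in>T. coeff (coeff (Det c) (snd t)) (fst t)) \<in> polynomial_maps (coeff_index B)"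
    by (rule polynomial_maps_prod) (rule coeffs)
  have f: "f \<in> polynomial_maps (coeff_index B)"
    unfolding f_def using coord prod by (rule polynomial_maps.mult)
  obtain a where a: "(\<Prod>t\<in>T. coeff (coeff (Det a) (snd t)) (fst t)) \<noteq> 0"
  proof -
    have "\<exists>c. (\<Prod>t\<in>T. coeff (coeff (Det c) (snd t)) (fst t)) \<noteq> 0"
    proof (rule polynomial_maps_prod_nonzero[OF finT])
      show "\<exists>c. coeff (coeff (Det c) (snd t)) (fst t) \<noteq> 0" if "t \<in> T" for t
        using subsetD[OF T(1) that] by (cases t) (auto simp: generic_support_def support2_def)
    qed (rule coeffs)
    then show ?thesis using that by blast
  qed
  obtain d where d: "f d \<noteq> 0"
  proof -
    have "(\<lambda>_. 1 :: complex) (l, u) \<noteq> 0" by simp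
    from polynomial_maps_mult_nonzero[where f = "\<lambda>c. c (l, u)", OF coord prod this a] show ?thesis
      using that unfolding f_def by blast
  qed
  show ?thesis
  proof (rule generically_nonvanishing[OF f d], intro allI impI)
    fix c \<phi> assume c: "f c \<noteq> 0" and impl: "implicitization B c \<phi>"
    have T_sub: "T \<subseteq> support2 (Det c)"
      using c finT by (auto simp: f_def support2_def)
    then have "Det c \<noteq> 0" using T(2) by (auto simp: support2_def)
    moreover have "coeff (supp_poly B c l) u \<noteq> 0"
      using c l fin by (auto simp: f_def coeff_supp_poly)
    ultimately obtain b where b: "b \<noteq> 0" "Det c = Polynomial.smult [:b:] \<phi>"
      using implicit_equation_proportional[OF impl degree_le_u u] l(1) unfolding Det_def by blast
    then have "support2 \<phi> = support2 (Det c)" by (simp add: support2_def)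
    then show "Q \<phi>" using T_sub by (intro Q) (simp_all add: newton_polygon_eq)
  qed
qed

end

section \<open>The two Newton polygons\<close>

lemma hull_eq_interval_endpoints:
  fixes S :: "nat set" and u :: nat
  assumes "convex hull (real ` S) = {0..real u}"
  shows "0 \<in> S" "u \<in> S"
proof -
  have S: "s \<le> u" if "s \<in> S" for s
    using hull_subset[of "real ` S" convex] that unfolding assms by auto
  show "0 \<in> S"
  proof (rule ccontr)
    assume "0 \<notin> S"
    then have "real ` S \<subseteq> {0<..}" by (auto simp: image_subset_iff) (metis gr0I)
    then have "convex hull (real ` S) \<subseteq> {0<..}" by (rule hull_minimal) (rule convex_real_interval)
    then have "(0::real) \<in> {0<..}" unfolding assms by (rule subsetD) simp
    then show False by simp
  qed
  show "u \<in> S"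
  proof (rule ccontr)
    assume "u \<notin> S"
    then have "real ` S \<subseteq> {..<real u}" using S by (auto simp: image_subset_iff) (metis le_neq_implies_less)
    then have "convex hull (real ` S) \<subseteq> {..<real u}" by (rule hull_minimal) (rule convex_real_interval)
    then have "real u \<in> {..<real u}" unfolding assms by (rule subsetD) simp
    then show False by simp
  qed
qed

text \<open>Fibres of a constant parameterization are infinite and have cardinality 0. This rules out \<open>u = 0\<close>.\<close>

lemma param_degree_1_nonconstant:
  assumes "has_param_degree P0 P1 Q 1"
  shows "degree P0 \<noteq> 0 \<or> degree P1 \<noteq> 0 \<or> degree Q \<noteq> 0"
proof (rule ccontr)
  assume "\<not> ?thesis"
  then obtain a b c where abc: "P0 = [:a:]" "P1 = [:b:]" "Q = [:c:]"
    by (metis degree_eq_zeroE)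
  have "frequently (\<lambda>_. True) (cofinite :: complex filter)"
    by (simp add: frequently_const infinite_UNIV_char_0)
  then show False
    using assms infinite_UNIV_char_0[where 'a = complex] unfolding has_param_degree_def abc
    by (auto dest!: eventually_happens')
qed

context param_supports
begin

text \<open>A monomial \<open>t ^ \<alpha>\<close> in one of the two blocks \<open>i\<close>, \<open>k\<close> and the exponents 0 and \<open>u\<close>, as far as
  needed, in the other one suffice. If 0 and \<open>u\<close> belong to different blocks, then \<open>\<alpha>\<close> itself is one
  of them.\<close>

lemma corner_in_support:
  assumes roles: "{i, j, k} = {0, 1, 2}" and ne: "B i \<noteq> {}" "B j \<noteq> {}" "B k \<noteq> {}"
    and ends: "0 \<in> B i \<union> B k" "u \<in> B i \<union> B k"
  shows "\<exists>t\<in>generic_support. hom_coord u i (real_point t) = 0 \<and> hom_coord u j (real_point t) = real u"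
proof -
  obtain a b d where mem: "a \<in> B i" "b \<in> B j" "d \<in> B k" using ne by blast
  have "{k, j, i} = {i, j, k}" by auto
  with roles have flip: "{k, j, i} = {0, 1, 2}" by (rule trans[rotated])
  have m: "i \<in> {0, 1, 2}" "j \<in> {0, 1, 2}" "k \<in> {0, 1, 2}" using roles by blast+
  note dd = roles_distinct[OF roles]
  have sum: "hom_coord u i x + hom_coord u j x + hom_coord u k x = real u" for x
    using m dd unfolding hom_coord_def by (elim insertE emptyE; simp)
  consider "0 \<in> B k" "u \<in> B k" | "0 \<in> B i" "u \<in> B k" | "0 \<in> B k" "u \<in> B i" | "0 \<in> B i" "u \<in> B i"
    using ends by blast
  then show ?thesis
  proof cases
    case 1
    have "\<exists>t\<in>generic_support. hom_coord u i (real_point t) = 0 \<and> hom_coord u j (real_point t) = real u - real a + real a"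
      by (rule edge_vertex_in_support[OF roles mem(1,1,2) 1]) simp_all
    then show ?thesis by simp
  next
    case 2
    have "\<exists>t\<in>generic_support. hom_coord u i (real_point t) = 0 \<and> hom_coord u j (real_point t) = real u - real 0 + real 0"
      by (rule edge_vertex_in_support[OF roles 2(1,1) mem(2)]) (simp_all add: 2)
    then show ?thesis by simp
  next
    case 3
    have "\<exists>t\<in>generic_support. hom_coord u i (real_point t) = 0 \<and> hom_coord u j (real_point t) = real u - real u + real u"
      by (rule edge_vertex_in_support[OF roles 3(2,2) mem(2)]) (simp_all add: 3)
    then show ?thesis by simp
  next
    case 4
    have "\<exists>t\<in>generic_support. hom_coord u k (real_point t) = 0 \<and> hom_coord u j (real_point t) = real u - real d + real d"
      by (rule edge_vertex_in_support[OF flip mem(3,3,2) 4]) simp_all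
    then obtain t where t: "t \<in> generic_support" "hom_coord u k (real_point t) = 0" "hom_coord u j (real_point t) = real u"
      by auto
    then show ?thesis using sum[of "real_point t"] by (intro bexI[of _ t]) simp_all
  qed
qed

lemma generic_triangle:
  assumes u: "0 < u" and ne: "\<And>r. r \<in> {0, 1, 2} \<Longrightarrow> B r \<noteq> {}"
    and ends: "\<And>r s. r \<in> {0, 1, 2} \<Longrightarrow> s \<in> {0, 1, 2} \<Longrightarrow> r \<noteq> s \<Longrightarrow> 0 \<in> B r \<union> B s \<and> u \<in> B r \<union> B s"
  shows "generically (coeff_index B) (\<lambda>c. \<forall>\<phi>. implicitization B c \<phi> \<longrightarrow>
    newton_polygon \<phi> = convex hull {(0, 0), (0, real u), (real u, 0)})"
proof (rule generic_newton_polygon[OF u])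
  let ?T = "{(0, 0), (0, u), (u, 0)}" and ?V = "{(0, 0), (0, real u), (real u, 0)}"
  have "(u, 0) \<in> generic_support"
  proof -
    have "\<exists>t\<in>generic_support. hom_coord u 1 (real_point t) = 0 \<and> hom_coord u 0 (real_point t) = real u"
      by (rule corner_in_support[of 1 0 2]) (use ne ends[of 1 2] in \<open>simp_all add: insert_commute\<close>)
    then obtain m n where "(m, n) \<in> generic_support" "hom_coord u 1 (real m, real n) = 0" "hom_coord u 0 (real m, real n) = real u"
      by (auto simp: real_point_def)
    moreover from this have "(m, n) = (u, 0)" by (simp add: hom_coord_def)
    ultimately show ?thesis by simp
  qed
  moreover have "(0, u) \<in> generic_support"
  proof -
    have "\<exists>t\<in>generic_support. hom_coord u 0 (real_point t) = 0 \<and> hom_coord u 1 (real_point t) = real u"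
      by (rule corner_in_support[of 0 1 2]) (use ne ends[of 0 2] in \<open>simp_all add: insert_commute\<close>)
    then obtain m n where "(m, n) \<in> generic_support" "hom_coord u 0 (real m, real n) = 0" "hom_coord u 1 (real m, real n) = real u"
      by (auto simp: real_point_def)
    moreover from this have "(m, n) = (0, u)" by (simp add: hom_coord_def)
    ultimately show ?thesis by simp
  qed
  moreover have "(0, 0) \<in> generic_support"
  proof -
    have "\<exists>t\<in>generic_support. hom_coord u 0 (real_point t) = 0 \<and> hom_coord u 2 (real_point t) = real u"
      by (rule corner_in_support[of 0 2 1]) (use ne ends[of 0 1] in \<open>simp_all add: insert_commute\<close>)
    then obtain m n where "(m, n) \<in> generic_support" "hom_coord u 0 (real m, real n) = 0" "hom_coord u 2 (real m, real n) = real u"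
      by (auto simp: real_point_def)
    moreover from this have "(m, n) = (0, 0)" by (simp add: hom_coord_def)
    ultimately show ?thesis by simp
  qed
  ultimately show "?T \<subseteq> generic_support" by simp
  show "?T \<noteq> {}" by simp
  fix c \<phi>
  let ?X = "real_point ` support2 (Det c)"
  assume \<phi>: "newton_polygon \<phi> = convex hull ?X" and T: "?T \<subseteq> support2 (Det c)"
  have "?V = real_point ` ?T" by (simp add: real_point_def)
  then have "?V \<subseteq> ?X" using T by blast
  moreover have "?X \<subseteq> convex hull ?V"
  proof (rule subset_convex_hullI)
    fix a x :: "real \<times> real" assume "x \<in> ?X"
    then obtain m n where x: "x = (real m, real n)" and "(m, n) \<in> support2 (Det c)"
      by (auto simp: real_point_def)
    then have le: "real m + real n \<le> real u" using support_bounds[of m n c] by linarith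
    obtain a0 a1 where a: "a = (a0, a1)" by (cases a)
    show "\<exists>v\<in>?V. inner a v \<le> inner a x"
    proof (cases "0 \<le> a0 \<and> 0 \<le> a1")
      case True
      then have "0 \<le> a0 * real m + a1 * real n" by simp
      then show ?thesis by (simp add: a x)
    next
      case False
      then have neg: "min a0 a1 < 0" by auto
      have "min a0 a1 * real u \<le> min a0 a1 * (real m + real n)"
        using le neg by (intro mult_left_mono_neg) auto
      also have "\<dots> = min a0 a1 * real m + min a0 a1 * real n" by (simp add: algebra_simps)
      also have "\<dots> \<le> a0 * real m + a1 * real n"
        by (intro add_mono mult_right_mono) auto
      finally show ?thesis by (cases "a0 \<le> a1") (simp_all add: a x)
    qed
  qed simp
  ultimately show "newton_polygon \<phi> = convex hull ?V"
    unfolding \<phi> by (intro antisym hull_minimal hull_mono convex_convex_hull)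
qed

text \<open>\<open>C\<close> is the list of candidates from \<open>pentagon_support_function\<close>; each of them is attained by
  \<open>edge_vertex_in_support\<close> (the first two with a single exponent in block \<open>i\<close> or \<open>j\<close>) or by
  \<open>inner_vertex_in_support\<close>. So the hull of \<open>T\<close> has the support function of \<open>N(\<phi>)\<close>, and the
  vertices are among the points of \<open>T\<close>.\<close>

lemma generic_pentagon:
  fixes ai aj zi zj :: nat
  assumes u: "0 < u" and roles: "{i, j, k} = {0, 1, 2}"
    and ends: "0 \<in> B k" "u \<in> B k"
    and Bi: "ai \<in> B i" "u - zi \<in> B i" "B i \<subseteq> {ai..u - zi}" "ai + zi \<le> u"
    and Bj: "aj \<in> B j" "u - zj \<in> B j" "B j \<subseteq> {aj..u - zj}" "aj + zj \<le> u"
    and order: "aj * zi \<le> ai * zj"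
  defines "V \<equiv> {(real u, 0), (0, real u), (0, real zi + real ai), (real aj, real zi), (real aj + real zj, 0)}"
  shows "generically (coeff_index B) (\<lambda>c. \<forall>\<phi>. implicitization B c \<phi> \<longrightarrow>
    card (vertices (newton_polygon \<phi>)) \<le> 5 \<and>
    (\<lambda>e. (hom_coord u i e, hom_coord u j e)) ` vertices (newton_polygon \<phi>) \<subseteq> V)"
proof -
  let ?h = "\<lambda>e. (hom_coord u i e, hom_coord u j e)"
  have "{j, i, k} = {i, j, k}" by auto
  with roles have flip: "{j, i, k} = {0, 1, 2}" by (rule trans[rotated])
  have m: "i \<in> {0, 1, 2}" "j \<in> {0, 1, 2}" "k \<in> {0, 1, 2}" using roles by blast+
  define C where "C = {(real u, 0), (0, real u)} \<union> {v. 0 < real aj \<and> v = (0, real zi + real ai)}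
    \<union> {v. 0 < real zi \<and> v = (real aj + real zj, 0)} \<union> {v. real aj + real zi < real u \<and> v = (real aj, real zi)}"
  have C_V: "C \<subseteq> V" by (auto simp: C_def V_def)
  define T where "T = {t \<in> generic_support. ?h (real_point t) \<in> C}"
  have attained: "\<exists>t\<in>T. ?h (real_point t) = v" if v: "v \<in> C" for v
  proof -
    have "\<exists>t\<in>generic_support. ?h (real_point t) = v"
    proof -
      consider (A) "v = (real u, 0)" | (B) "v = (0, real u)" | (C) "0 < aj" "v = (0, real zi + real ai)"
        | (E) "0 < zi" "v = (real aj + real zj, 0)" | (D) "aj + zi < u" "v = (real aj, real zi)"
        using v by (auto simp: C_def)
      then show ?thesis
      proof cases
        case A
        have "\<exists>t\<in>generic_support. hom_coord u j (real_point t) = 0 \<and> hom_coord u i (real_point t) = real u - real aj + real aj"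
          by (rule edge_vertex_in_support[OF flip Bj(1,1) Bi(1) ends]) simp_all
        then show ?thesis using A by auto
      next
        case B
        have "\<exists>t\<in>generic_support. hom_coord u i (real_point t) = 0 \<and> hom_coord u j (real_point t) = real u - real ai + real ai"
          by (rule edge_vertex_in_support[OF roles Bi(1,1) Bj(1) ends]) simp_all
        then show ?thesis using B by auto
      next
        case C
        \<comment> \<open>the exponent \<open>aj\<close> of block \<open>j\<close> must not be \<open>u\<close> if block \<open>k\<close> has to use the exponent \<open>u\<close>\<close>
        have "aj = u \<Longrightarrow> zi = 0" using order Bj(4) u by simp
        then have "u - zi = u \<or> aj < u" using Bj(4) by linarith
        then have "\<exists>t\<in>generic_support. hom_coord u i (real_point t) = 0 \<and> hom_coord u j (real_point t) = real u - real (u - zi) + real ai"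
          using C Bi(4) by (intro edge_vertex_in_support[OF roles Bi(1,2) Bj(1) ends]) simp_all
        then show ?thesis using C Bi(4) by (auto simp: of_nat_diff)
      next
        case E
        \<comment> \<open>the exponent \<open>u - zi\<close> of block \<open>i\<close> must not be 0 if block \<open>k\<close> has to use the exponent 0\<close>
        have "aj = 0" if "u - zi = 0"
        proof -
          have "zi = u" "ai = 0" using that Bi(4) by simp_all
          then show ?thesis using order u by simp
        qed
        then have "aj = 0 \<or> 0 < u - zi" by linarith
        then have "\<exists>t\<in>generic_support. hom_coord u j (real_point t) = 0 \<and> hom_coord u i (real_point t) = real u - real (u - zj) + real aj"
          using E Bj(4) u by (intro edge_vertex_in_support[OF flip Bj(1,2) Bi(2) ends]) simp_all
        then show ?thesis using E Bj(4) by (auto simp: of_nat_diff add.commute)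
      next
        case D
        then have "aj < u - zi" by simp
        with inner_vertex_in_support[OF roles Bi(2) Bj(1) ends]
        have "\<exists>t\<in>generic_support. hom_coord u i (real_point t) = real aj \<and> hom_coord u j (real_point t) = real u - real (u - zi)" .
        then show ?thesis using D by (auto simp: of_nat_diff)
      qed
    qed
    then show ?thesis using v by (auto simp: T_def)
  qed
  show ?thesis
  proof (rule generic_newton_polygon[OF u, of T])
    show "T \<subseteq> generic_support" by (auto simp: T_def)
    show "T \<noteq> {}" using attained[of "(real u, 0)"] by (auto simp: C_def)
    fix c \<phi>
    let ?X = "real_point ` support2 (Det c)"
    assume \<phi>: "newton_polygon \<phi> = convex hull ?X" and T: "T \<subseteq> support2 (Det c)"
    have "?X \<subseteq> convex hull (real_point ` T)"
    proof (rule subset_convex_hullI)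
      show "finite (real_point ` T)"
        using finite_generic_support by (simp add: T_def)
      fix a x :: "real \<times> real" assume "x \<in> ?X"
      then obtain m n where x: "x = (real m, real n)" and "(m, n) \<in> support2 (Det c)"
        by (auto simp: real_point_def)
      from support_placement[OF this(2)] obtain F where F: "placement u B F"
        and num: "\<forall>r\<in>{0, 1, 2}. hom_coord u r x = real (num_ext u F r)"
        unfolding x by blast
      interpret placement_roles u B F i j k by (rule placement_roles.intro[OF roles F])
      \<comment> \<open>the functional \<open>a\<close> as weights on \<open>(e\<^sub>0, e\<^sub>1, e\<^sub>2)\<close>; since the coordinates add up to \<open>u\<close>, subtracting \<open>\<alpha> k\<close> from all three weights only shifts it by a constant\<close>
      define \<alpha> where "\<alpha> l = (if l = 0 then fst a else if l = 1 then snd a else 0)" for l :: nat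
      have inner: "inner a y = (\<alpha> i - \<alpha> k) * hom_coord u i y + (\<alpha> j - \<alpha> k) * hom_coord u j y + \<alpha> k * real u" for y
        unfolding \<alpha>_def by (rule inner_eq_hom_coord[OF roles])
      have "\<exists>(vi, vj) \<in> C. (\<alpha> i - \<alpha> k) * vi + (\<alpha> j - \<alpha> k) * vj
          \<le> (\<alpha> i - \<alpha> k) * real (num_ext u F i) + (\<alpha> j - \<alpha> k) * real (num_ext u F j)"
        unfolding C_def
      proof (rule pentagon_support_function)
        show "real (num_ext u F i) + real (num_ext u F j) \<le> real u"
          using sum_num_ext by linarith
        show "real aj * real zi \<le> real ai * real zj"
          using order by (metis of_nat_le_iff of_nat_mult)
        fix \<mu> \<kappa>
        assume "0 \<le> \<mu>" "\<mu> * real ai \<le> \<alpha> i - \<alpha> k" "\<mu> * real aj \<le> \<alpha> j - \<alpha> k"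
          "0 \<le> \<kappa>" "\<kappa> * real zi \<le> \<alpha> i - \<alpha> k" "\<kappa> * real zj \<le> \<alpha> j - \<alpha> k"
        then show "\<mu> * (real ai * real aj) + \<kappa> * (real zi * real zj)
            \<le> (\<alpha> i - \<alpha> k) * real (num_ext u F i) + (\<alpha> j - \<alpha> k) * real (num_ext u F j)"
          using weight_bound[OF Bi(3) Bj(3) Bi(4) Bj(4)] by simp
      qed simp_all
      then obtain vi vj where v: "(vi, vj) \<in> C"
        and le: "(\<alpha> i - \<alpha> k) * vi + (\<alpha> j - \<alpha> k) * vj
          \<le> (\<alpha> i - \<alpha> k) * real (num_ext u F i) + (\<alpha> j - \<alpha> k) * real (num_ext u F j)"
        by blast
      obtain t where t: "t \<in> T" "?h (real_point t) = (vi, vj)" using attained[OF v] by blast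
      have "inner a (real_point t) \<le> inner a x"
        unfolding inner using t(2) le bspec[OF num m(1)] bspec[OF num m(2)] by simp
      then show "\<exists>v\<in>real_point ` T. inner a v \<le> inner a x" using t(1) by blast
    qed
    then have hull: "newton_polygon \<phi> = convex hull (real_point ` T)"
      unfolding \<phi> using T by (intro antisym hull_minimal hull_mono convex_convex_hull) auto
    have "?h ` vertices (newton_polygon \<phi>) \<subseteq> ?h ` real_point ` T"
      unfolding hull vertices_def using extreme_point_of_convex_hull by blast
    also have "\<dots> \<subseteq> V" using C_V by (auto simp: T_def)
    finally have sub: "?h ` vertices (newton_polygon \<phi>) \<subseteq> V" .
    have "card (vertices (newton_polygon \<phi>)) = card (?h ` vertices (newton_polygon \<phi>))"
      using hom_coord_inj[OF roles] by (intro card_image[symmetric]) (rule inj_on_subset[OF _ subset_UNIV])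
    also have "\<dots> \<le> card V" using sub by (intro card_mono) (simp_all add: V_def)
    also have "\<dots> \<le> 5" unfolding V_def by (simp add: card_insert_if)
    finally show "card (vertices (newton_polygon \<phi>)) \<le> 5 \<and> ?h ` vertices (newton_polygon \<phi>) \<subseteq> V"
      using sub by simp
  qed
qed

end

theorem theorem16:
  fixes B :: "nat \<Rightarrow> nat set" and u :: nat
  assumes "\<And>i. i \<in> {0, 1, 2} \<Longrightarrow> finite (B i) \<and> B i \<noteq> {}"
    and "u = Max {Max (B 0), Max (B 1), Max (B 2)}"
  shows
    "((\<forall>i\<in>{0, 1, 2}. \<forall>j\<in>{0, 1, 2}. i \<noteq> j \<longrightarrow> convex hull (real ` (B i \<union> B j)) = {0..real u}) \<longrightarrow>
        generically (coeff_index B) (\<lambda>c. \<forall>\<phi>. implicitization B c \<phi> \<longrightarrow>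
          newton_polygon \<phi> = convex hull {(0, 0), (0, real u), (real u, 0)}))
     \<and>
     (\<forall>i j k.
        {i, j, k} = {0, 1, 2} \<and>
        {l \<in> {0, 1, 2}. Min (B l) = 0 \<and> Max (B l) = u} = {k} \<and>
        real (Min (B i)) * (real u - real (Max (B j))) \<ge> real (Min (B j)) * (real u - real (Max (B i)))
        \<longrightarrow>
        generically (coeff_index B) (\<lambda>c. \<forall>\<phi>. implicitization B c \<phi> \<longrightarrow>
          card (vertices (newton_polygon \<phi>)) \<le> 5 \<and>
          (\<lambda>e. (hom_coord u i e, hom_coord u j e)) ` vertices (newton_polygon \<phi>) \<subseteq>
            {(real u, 0), (0, real u),
             (0, real u - real (Max (B i)) + real (Min (B i))),
             (real (Min (B j)), real u - real (Max (B i))),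
             (real u - real (Max (B j)) + real (Min (B j)), 0)}))"
proof -
  have fin: "finite (B r)" and ne: "B r \<noteq> {}" if "r \<in> {0, 1, 2}" for r
    using assms(1)[OF that] by auto
  have Max_le: "Max (B r) \<le> u" if "r \<in> {0, 1, 2}" for r
    unfolding assms(2) using that by (intro Max_ge) auto
  have le: "b \<le> u" if "r \<in> {0, 1, 2}" "b \<in> B r" for r b
    using Max_ge[OF fin[OF that(1)] that(2)] Max_le[OF that(1)] by simp
  have "u \<in> {Max (B 0), Max (B 1), Max (B 2)}"
    unfolding assms(2) by (rule Max_in) simp_all
  then have top: "\<exists>l\<in>{0, 1, 2}. u \<in> B l"
    using Max_in[OF fin ne] by auto
  interpret param_supports B u
    using fin le top by unfold_locales
  show ?thesis
  proof (intro conjI impI allI)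
    assume hull: "\<forall>i\<in>{0, 1, 2}. \<forall>j\<in>{0, 1, 2}. i \<noteq> j \<longrightarrow> convex hull (real ` (B i \<union> B j)) = {0..real u}"
    show "generically (coeff_index B) (\<lambda>c. \<forall>\<phi>. implicitization B c \<phi> \<longrightarrow>
        newton_polygon \<phi> = convex hull {(0, 0), (0, real u), (real u, 0)})"
    proof (cases "u = 0")
      case False
      show ?thesis
      proof (rule generic_triangle)
        fix r s :: nat assume "r \<in> {0, 1, 2}" "s \<in> {0, 1, 2}" "r \<noteq> s"
        with hull have "convex hull (real ` (B r \<union> B s)) = {0..real u}" by blast
        from hull_eq_interval_endpoints[OF this] show "0 \<in> B r \<union> B s \<and> u \<in> B r \<union> B s" ..
      qed (use False ne in auto)
    next
      case True
      have "\<not> implicitization B c \<phi>" for c \<phi>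
        using param_degree_1_nonconstant[of "supp_poly B c 0" "supp_poly B c 1" "supp_poly B c 2"]
          degree_le_u[of _ c] True by (auto simp: implicitization_def Let_def)
      then show ?thesis
        by (intro generically_nonvanishing[where f = "\<lambda>_. 1", OF polynomial_maps.const]) simp_all
    qed
  next
    fix i j k
    let ?k = "{l \<in> {0, 1, 2}. Min (B l) = 0 \<and> Max (B l) = u} = {k}"
    assume *: "{i, j, k} = {0, 1, 2} \<and> ?k \<and>
        real (Min (B i)) * (real u - real (Max (B j))) \<ge> real (Min (B j)) * (real u - real (Max (B i)))"
    note roles = *[THEN conjunct1] and k = *[THEN conjunct2, THEN conjunct1]
      and ineq = *[THEN conjunct2, THEN conjunct2]
    have m: "i \<in> {0, 1, 2}" "j \<in> {0, 1, 2}" "k \<in> {0, 1, 2}" using roles by blast+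
    have "i \<noteq> k" using roles_distinct[OF roles] by simp
    have "k \<in> {l \<in> {0, 1, 2}. Min (B l) = 0 \<and> Max (B l) = u}" unfolding k by simp
    then have "Min (B k) = 0" "Max (B k) = u" by simp_all
    then have ends: "0 \<in> B k" "u \<in> B k"
      using Min_in[OF fin[OF m(3)] ne[OF m(3)]] Max_in[OF fin[OF m(3)] ne[OF m(3)]] by simp_all
    have bnds: "Min (B r) \<in> B r" "u - (u - Max (B r)) \<in> B r" "B r \<subseteq> {Min (B r)..u - (u - Max (B r))}"
      "Min (B r) + (u - Max (B r)) \<le> u" if r: "r \<in> {0, 1, 2}" for r
    proof -
      have "u - (u - Max (B r)) = Max (B r)" using Max_le[OF r] by simp
      then show "Min (B r) \<in> B r" "u - (u - Max (B r)) \<in> B r" "B r \<subseteq> {Min (B r)..u - (u - Max (B r))}"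
        using fin[OF r] ne[OF r] by (auto intro: Min_le Max_ge)
      have "Min (B r) \<le> Max (B r)" using fin[OF r] ne[OF r] by simp
      then show "Min (B r) + (u - Max (B r)) \<le> u" using Max_le[OF r] by simp
    qed
    have u: "0 < u"
    proof (rule ccontr)
      assume "\<not> 0 < u"
      then have "Min (B i) = 0 \<and> Max (B i) = u"
        using Max_le[OF m(1)] bnds(4)[OF m(1)] by auto
      then have "i \<in> {l \<in> {0, 1, 2}. Min (B l) = 0 \<and> Max (B l) = u}" using m(1) by simp
      then have "i \<in> {k}" unfolding k .
      then show False using \<open>i \<noteq> k\<close> by simp
    qed
    have diff: "real (u - Max (B r)) = real u - real (Max (B r))" if "r \<in> {0, 1, 2}" for r
      using Max_le[OF that] by (rule of_nat_diff)
    have "real (Min (B j) * (u - Max (B i))) \<le> real (Min (B i) * (u - Max (B j)))"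
      using ineq unfolding of_nat_mult diff[OF m(1)] diff[OF m(2)] .
    then have order: "Min (B j) * (u - Max (B i)) \<le> Min (B i) * (u - Max (B j))"
      by (simp only: of_nat_le_iff)
    have swap: "real u - real (Max (B j)) + real (Min (B j)) = real (Min (B j)) + (real u - real (Max (B j)))"
      by simp
    show "generically (coeff_index B) (\<lambda>c. \<forall>\<phi>. implicitization B c \<phi> \<longrightarrow>
        card (vertices (newton_polygon \<phi>)) \<le> 5 \<and>
        (\<lambda>e. (hom_coord u i e, hom_coord u j e)) ` vertices (newton_polygon \<phi>) \<subseteq>
          {(real u, 0), (0, real u),
           (0, real u - real (Max (B i)) + real (Min (B i))),
           (real (Min (B j)), real u - real (Max (B i))),
           (real u - real (Max (B j)) + real (Min (B j)), 0)})"
      using generic_pentagon[OF u roles ends bnds[OF m(1)] bnds[OF m(2)] order]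
      unfolding diff[OF m(1)] diff[OF m(2)] swap .
  qed
qed

end
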